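(* Let $\mathcal R$ be a module category over the affine Brauer category $\mathcal{AB}$ that is either a locally finite abelian or a schurian category, and let $L\in\mathcal R$ be a brick, i.e. $\mathrm{End}_{\mathcal R}(L)=\Bbbk$. Let $m_L\in\Bbbk[u]$ be the monic minimal polynomial of the dot acting on $BL$, and let $\mathbb O_L(u)\in 1+u^{-1}\Bbbk[[u^{-1}]]$ be the series by which $\beta_r(u)$ acts on $L$. Then $\mathbb O_L=\mathbb O_{m_L}$, that is, $$\mathbb O_L(u)=\frac{\left((-1)^{\deg m_L}u-\frac12\right)m_L(-u)}{\left(u-\frac12\right)m_L(u)}$$ (the right-hand side being expanded at $u=\infty$).
   Context: $\Bbbk$ is a field of characteristic different from $2$. The affine Brauer category $\mathcal{AB}$ is the strict $\Bbbk$-linear monoidal category (unit object $\mathbf 1$) generated by one object $B$ and morphisms $\mathrm{cap}\colon B\otimes B\to\mathbf 1$, $\mathrm{cup}\colon\mathbf 1\to B\otimes B$, $s\colon B\otimes B\to B\otimes B$, $x\colon B\to B$ (the dot), subject to the relations (with $I=1_B$): $s\circ s=1_{B\otimes B}$; $(s\otimes I)(I\otimes s)(s\otimes I)=(I\otimes s)(s\otimes I)(I\otimes s)$; $(I\otimes \mathrm{cap})(\mathrm{cup}\otimes I)=I=(\mathrm{cap}\otimes I)(I\otimes\mathrm{cup})$; $\mathrm{cap}\circ s=\mathrm{cap}$; $(I\otimes\mathrm{cap})(s\otimes I)=(\mathrm{cap}\otimes I)(I\otimes s)$; $(x\otimes I)s-s(I\otimes x)=1_{B\otimes B}-\mathrm{cup}\circ\mathrm{cap}$;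 $\mathrm{cap}(x\otimes I)=-\mathrm{cap}(I\otimes x)$. Define $\beta_r(u)=1_{\mathbf 1}+\frac{2u}{2u-1}\sum_{n\ge0}\left(\mathrm{cap}\circ(I\otimes x^n)\circ\mathrm{cup}\right)u^{-n-1}\in\mathrm{End}(\mathbf 1)[[u^{-1}]]$, with $\frac{2u}{2u-1}$ expanded in powers of $u^{-1}$. A module category over $\mathcal{AB}$ is a $\Bbbk$-linear category $\mathcal R$ with a strict $\Bbbk$-linear monoidal functor from $\mathcal{AB}$ to the category of $\Bbbk$-linear endofunctors of $\mathcal R$ and natural transformations; write $XL$ for the value at $L$ of the functor attached to $X\in\mathcal{AB}$, and let morphisms of $\mathcal{AB}$ act by the components of the corresponding natural transformations. Locally finite abelian means abelian with all objects of finite length and all morphism spaces finite-dimensional over $\Bbbk$; schurian means equivalent to the category of locally finite-dimensional modules over a locally finite-dimensional locally unital $\Bbbk$-algebra. Under these finiteness assumptions $\mathrm{End}_{\mathcal R}(BL)$ is finite-dimensional when $L$ is a brick, and $m_L$ is the unique monic generator of the (nonzero) kernel $I_L$ of the algebra homomorphism $\Bbbk[u]\to\mathrm{End}_{\mathcal R}(BL)$, $f(u)\mapsto f(x)_L$. For $f\in\Bbbk[u]$ nonzero, $\mathbb O_f(u):=\frac{\left((-1)^{\deg f}u-\frac12\right)f(-u)}{(u-\frac12)f(u)}\in1+u^{-1}\Bbbk[[u^{-1}]]$. *)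

theory Defs
  imports "HOL-Algebra.Algebraic_Closure_Type" "HOL-Library.FuncSet"
begin

no_notation var (\<open>X\<index>\<close>)  \<comment> \<open>frees the name \<open>X\<close>\<close>

section \<open>Linear categories\<close>

text \<open>
  Vector spaces are modules (in the sense of HOL-Algebra) over the ring record
  \<^const>\<open>ring_of_type_algebra\<close> of a type \<open>'k\<close> of class \<^class>\<open>field\<close>.
  The fields \<open>mult\<close> and \<open>one\<close> of a module record are irrelevant for its module structure.
\<close>

abbreviation vector_space_over_k :: "('k::field, 'm, 'z) module_scheme \<Rightarrow> bool"
  where "vector_space_over_k M \<equiv> Module.module (ring_of_type_algebra :: 'k ring) M"

definition mk_module ::
  "'m set \<Rightarrow> 'm \<Rightarrow> ('m \<Rightarrow> 'm \<Rightarrow> 'm) \<Rightarrow> ('k \<Rightarrow> 'm \<Rightarrow> 'm) \<Rightarrow> ('k, 'm) module"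
  where "mk_module V z p s =
    \<lparr>carrier = V, monoid.mult = (\<lambda>_ _. undefined), one = undefined,
     ring.zero = z, add = p, module.smult = s\<rparr>"

definition linear_map ::
  "('k::field, 'v, 'y) module_scheme \<Rightarrow> ('k, 'w, 'z) module_scheme \<Rightarrow> ('v \<Rightarrow> 'w) \<Rightarrow> bool"
  where "linear_map V W f \<longleftrightarrow>
    f \<in> carrier V \<rightarrow> carrier W \<and>
    (\<forall>v\<in>carrier V. \<forall>w\<in>carrier V. f (v \<oplus>\<^bsub>V\<^esub> w) = f v \<oplus>\<^bsub>W\<^esub> f w) \<and>
    (\<forall>a. \<forall>v\<in>carrier V. f (a \<odot>\<^bsub>V\<^esub> v) = a \<odot>\<^bsub>W\<^esub> f v)"

text \<open>Intended for subspaces \<open>U\<close> of \<open>M\<close>: some finite subset of \<open>U\<close> spans \<open>U\<close>.\<close>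

definition finite_dim_subspace :: "('k::field, 'm, 'z) module_scheme \<Rightarrow> 'm set \<Rightarrow> bool"
  where "finite_dim_subspace M U \<longleftrightarrow>
    (\<exists>S. finite S \<and> S \<subseteq> U \<and> (\<forall>v\<in>U. \<exists>a. v = finsum M (\<lambda>s. a s \<odot>\<^bsub>M\<^esub> s) S))"

record ('o, 'm, 'k) lincat =
  Ob :: "'o set"
  Hom :: "'o \<Rightarrow> 'o \<Rightarrow> ('k, 'm) module"
  ident :: "'o \<Rightarrow> 'm"
  cmp :: "'m \<Rightarrow> 'm \<Rightarrow> 'm"  \<comment> \<open>\<open>cmp C g f\<close> is \<open>g\<close> after \<open>f\<close>\<close>

abbreviation Arr :: "('o, 'm, 'k, 'z) lincat_scheme \<Rightarrow> 'o \<Rightarrow> 'o \<Rightarrow> 'm set"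
  where "Arr C X Y \<equiv> carrier (Hom C X Y)"

abbreviation zero_mor :: "('o, 'm, 'k, 'z) lincat_scheme \<Rightarrow> 'o \<Rightarrow> 'o \<Rightarrow> 'm"
  where "zero_mor C X Y \<equiv> \<zero>\<^bsub>Hom C X Y\<^esub>"

definition arrows :: "('o, 'm, 'k, 'z) lincat_scheme \<Rightarrow> 'm set"
  where "arrows C = (\<Union>X\<in>Ob C. \<Union>Y\<in>Ob C. Arr C X Y)"

locale linear_category =
  fixes C :: "('o, 'm, 'k::field, 'z) lincat_scheme"
  assumes hom_vector_space:
      "\<lbrakk>X \<in> Ob C; Y \<in> Ob C\<rbrakk> \<Longrightarrow> vector_space_over_k (Hom C X Y)"
    and hom_disjoint:
      "\<lbrakk>X \<in> Ob C; Y \<in> Ob C; X' \<in> Ob C; Y' \<in> Ob C; f \<in> Arr C X Y; f \<in> Arr C X' Y'\<rbrakk>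
        \<Longrightarrow> X = X' \<and> Y = Y'"
    and ident_in: "X \<in> Ob C \<Longrightarrow> ident C X \<in> Arr C X X"
    and cmp_in:
      "\<lbrakk>X \<in> Ob C; Y \<in> Ob C; Z \<in> Ob C; f \<in> Arr C X Y; g \<in> Arr C Y Z\<rbrakk>
        \<Longrightarrow> cmp C g f \<in> Arr C X Z"
    and ident_left:
      "\<lbrakk>X \<in> Ob C; Y \<in> Ob C; f \<in> Arr C X Y\<rbrakk> \<Longrightarrow> cmp C (ident C Y) f = f"
    and ident_right:
      "\<lbrakk>X \<in> Ob C; Y \<in> Ob C; f \<in> Arr C X Y\<rbrakk> \<Longrightarrow> cmp C f (ident C X) = f"
    and cmp_assoc:
      "\<lbrakk>X \<in> Ob C; Y \<in> Ob C; Z \<in> Ob C; W \<in> Ob C;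
        f \<in> Arr C X Y; g \<in> Arr C Y Z; h \<in> Arr C Z W\<rbrakk>
        \<Longrightarrow> cmp C h (cmp C g f) = cmp C (cmp C h g) f"
    and cmp_linear_left:
      "\<lbrakk>X \<in> Ob C; Y \<in> Ob C; Z \<in> Ob C; f \<in> Arr C X Y\<rbrakk>
        \<Longrightarrow> linear_map (Hom C Y Z) (Hom C X Z) (\<lambda>g. cmp C g f)"
    and cmp_linear_right:
      "\<lbrakk>X \<in> Ob C; Y \<in> Ob C; Z \<in> Ob C; g \<in> Arr C Y Z\<rbrakk>
        \<Longrightarrow> linear_map (Hom C X Y) (Hom C X Z) (\<lambda>f. cmp C g f)"

subsection \<open>Functors and natural transformations\<close>

record ('o, 'm, 'p, 'n) lfunctor =
  fob :: "'o \<Rightarrow> 'p"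
  fmor :: "'m \<Rightarrow> 'n"

locale linear_functor =
  fixes C :: "('o, 'm, 'k::field, 'y) lincat_scheme"
    and D :: "('p, 'n, 'k, 'z) lincat_scheme"
    and F :: "('o, 'm, 'p, 'n) lfunctor"
  assumes fob_in: "X \<in> Ob C \<Longrightarrow> fob F X \<in> Ob D"
    and fmor_linear:
      "\<lbrakk>X \<in> Ob C; Y \<in> Ob C\<rbrakk>
        \<Longrightarrow> linear_map (Hom C X Y) (Hom D (fob F X) (fob F Y)) (fmor F)"
    and fmor_ident: "X \<in> Ob C \<Longrightarrow> fmor F (ident C X) = ident D (fob F X)"
    and fmor_cmp:
      "\<lbrakk>X \<in> Ob C; Y \<in> Ob C; Z \<in> Ob C; f \<in> Arr C X Y; g \<in> Arr C Y Z\<rbrakk>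
        \<Longrightarrow> fmor F (cmp C g f) = cmp D (fmor F g) (fmor F f)"

definition id_functor :: "('o, 'm, 'k, 'z) lincat_scheme \<Rightarrow> ('o, 'm, 'o, 'm) lfunctor"
  where "id_functor C = \<lparr>fob = (\<lambda>X\<in>Ob C. X), fmor = (\<lambda>f\<in>arrows C. f)\<rparr>"

text \<open>\<open>cmp_functor C G F\<close> is \<open>G\<close> after \<open>F\<close>, where \<open>C\<close> is the source of \<open>F\<close>.\<close>

definition cmp_functor ::
  "('o, 'm, 'k, 'z) lincat_scheme \<Rightarrow> ('p, 'n, 'q, 'r) lfunctor \<Rightarrow> ('o, 'm, 'p, 'n) lfunctor
    \<Rightarrow> ('o, 'm, 'q, 'r) lfunctor"
  where "cmp_functor C G F =
    \<lparr>fob = (\<lambda>X\<in>Ob C. fob G (fob F X)), fmor = (\<lambda>f\<in>arrows C. fmor G (fmor F f))\<rparr>"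

definition natural_transformation ::
  "('o, 'm, 'k::field, 'y) lincat_scheme \<Rightarrow> ('p, 'n, 'k, 'z) lincat_scheme
    \<Rightarrow> ('o, 'm, 'p, 'n) lfunctor \<Rightarrow> ('o, 'm, 'p, 'n) lfunctor \<Rightarrow> ('o \<Rightarrow> 'n) \<Rightarrow> bool"
  where "natural_transformation C D F G \<alpha> \<longleftrightarrow>
    (\<forall>X\<in>Ob C. \<alpha> X \<in> Arr D (fob F X) (fob G X)) \<and>
    (\<forall>X\<in>Ob C. \<forall>Y\<in>Ob C. \<forall>f\<in>Arr C X Y.
      cmp D (\<alpha> Y) (fmor F f) = cmp D (fmor G f) (\<alpha> X))"

definition is_iso :: "('o, 'm, 'k, 'z) lincat_scheme \<Rightarrow> 'o \<Rightarrow> 'o \<Rightarrow> 'm \<Rightarrow> bool"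
  where "is_iso C X Y f \<longleftrightarrow>
    f \<in> Arr C X Y \<and> (\<exists>g\<in>Arr C Y X. cmp C g f = ident C X \<and> cmp C f g = ident C Y)"

definition naturally_isomorphic ::
  "('o, 'm, 'k::field, 'y) lincat_scheme \<Rightarrow> ('p, 'n, 'k, 'z) lincat_scheme
    \<Rightarrow> ('o, 'm, 'p, 'n) lfunctor \<Rightarrow> ('o, 'm, 'p, 'n) lfunctor \<Rightarrow> bool"
  where "naturally_isomorphic C D F G \<longleftrightarrow>
    (\<exists>\<alpha>. natural_transformation C D F G \<alpha> \<and>
      (\<forall>X\<in>Ob C. is_iso D (fob F X) (fob G X) (\<alpha> X)))"

definition linearly_equivalent ::
  "('o, 'm, 'k::field, 'y) lincat_scheme \<Rightarrow> ('p, 'n, 'k, 'z) lincat_scheme \<Rightarrow> bool"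
  where "linearly_equivalent C D \<longleftrightarrow>
    (\<exists>F G. linear_functor C D F \<and> linear_functor D C G \<and>
      naturally_isomorphic C C (cmp_functor C G F) (id_functor C) \<and>
      naturally_isomorphic D D (cmp_functor D F G) (id_functor D))"

subsection \<open>Strict monoidal linear categories\<close>

record ('o, 'm, 'k) moncat = "('o, 'm, 'k) lincat" +
  unit_ob :: "'o"
  tens_ob :: "'o \<Rightarrow> 'o \<Rightarrow> 'o"
  tens_mor :: "'m \<Rightarrow> 'm \<Rightarrow> 'm"

locale strict_monoidal_functor =
  linear_functor C D F
  for C :: "('o, 'm, 'k::field, 'y) moncat_scheme"
    and D :: "('p, 'n, 'k, 'z) moncat_scheme"
    and F :: "('o, 'm, 'p, 'n) lfunctor" +
  assumes fob_unit: "fob F (unit_ob C) = unit_ob D"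
    and fob_tens:
      "\<lbrakk>X \<in> Ob C; Y \<in> Ob C\<rbrakk> \<Longrightarrow> fob F (tens_ob C X Y) = tens_ob D (fob F X) (fob F Y)"
    and fmor_tens:
      "\<lbrakk>X \<in> Ob C; X' \<in> Ob C; Y \<in> Ob C; Y' \<in> Ob C; f \<in> Arr C X X'; g \<in> Arr C Y Y'\<rbrakk>
        \<Longrightarrow> fmor F (tens_mor C f g) = tens_mor D (fmor F f) (fmor F g)"

text \<open>
  The strict monoidal category of linear endofunctors of \<open>C\<close>, with composition of functors
  as tensor product on objects and horizontal composition as tensor product on morphisms.
  Since equality of functors matters here, endofunctors and
  natural transformations are required to be undefined off \<open>C\<close>. A morphism is a natural
  transformation together with its source and target.
\<close>

type_synonym ('o, 'm) endofun = "('o, 'm, 'o, 'm) lfunctor"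
type_synonym ('o, 'm) nattrans = "('o, 'm) endofun \<times> ('o \<Rightarrow> 'm) \<times> ('o, 'm) endofun"

definition End_cat ::
  "('o, 'm, 'k::field, 'z) lincat_scheme
    \<Rightarrow> (('o, 'm) endofun, ('o, 'm) nattrans, 'k) moncat"
  where "End_cat C = \<lparr>
    Ob = {F. linear_functor C C F \<and>
      fob F \<in> extensional (Ob C) \<and> fmor F \<in> extensional (arrows C)},
    Hom = (\<lambda>F G. mk_module
      {(F, \<alpha>, G) | \<alpha>. natural_transformation C C F G \<alpha> \<and> \<alpha> \<in> extensional (Ob C)}
      (F, (\<lambda>X\<in>Ob C. zero_mor C (fob F X) (fob G X)), G)
      (\<lambda>(_, \<alpha>, _) (_, \<beta>, _).
        (F, (\<lambda>X\<in>Ob C. \<alpha> X \<oplus>\<^bsub>Hom C (fob F X) (fob G X)\<^esub> \<beta> X), G))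
      (\<lambda>a (_, \<alpha>, _). (F, (\<lambda>X\<in>Ob C. a \<odot>\<^bsub>Hom C (fob F X) (fob G X)\<^esub> \<alpha> X), G))),
    ident = (\<lambda>F. (F, (\<lambda>X\<in>Ob C. ident C (fob F X)), F)),
    cmp = (\<lambda>(_, \<beta>, H) (F, \<alpha>, _). (F, (\<lambda>X\<in>Ob C. cmp C (\<beta> X) (\<alpha> X)), H)),
    unit_ob = id_functor C,
    tens_ob = cmp_functor C,
    tens_mor = (\<lambda>(F, \<alpha>, F') (G, \<beta>, G').
      (cmp_functor C F G,
       (\<lambda>X\<in>Ob C. cmp C (\<alpha> (fob G' X)) (fmor F (\<beta> X))),
       cmp_functor C F' G'))\<rparr>"

section \<open>The affine Brauer category\<close>

text \<open>
  The objects are the tensor powers of \<open>B\<close>, so we take them to be natural numbers.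
  Morphisms are well-typed expressions in the generators modulo the congruence generated by the
  axioms of a strict linear monoidal category and the defining relations.
\<close>

datatype 'k ab_term =
    Idt nat
  | Cap
  | Cup
  | Swap
  | Dot
  | Cmp "'k ab_term" "'k ab_term"
  | Tens "'k ab_term" "'k ab_term"
  | Zero nat nat
  | Plus "'k ab_term" "'k ab_term"
  | Scale 'k "'k ab_term"

inductive ab_typed :: "'k ab_term \<Rightarrow> nat \<Rightarrow> nat \<Rightarrow> bool" where
  "ab_typed (Idt n) n n"
| "ab_typed Cap 2 0"
| "ab_typed Cup 0 2"
| "ab_typed Swap 2 2"
| "ab_typed Dot 1 1"
| "ab_typed t l m \<Longrightarrow> ab_typed s m n \<Longrightarrow> ab_typed (Cmp s t) l n"
| "ab_typed t m n \<Longrightarrow> ab_typed t' m' n' \<Longrightarrow> ab_typed (Tens t t') (m + m') (n + n')"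
| "ab_typed (Zero m n) m n"
| "ab_typed t m n \<Longrightarrow> ab_typed s m n \<Longrightarrow> ab_typed (Plus t s) m n"
| "ab_typed t m n \<Longrightarrow> ab_typed (Scale a t) m n"

abbreviation (input) Minus :: "'k::field ab_term \<Rightarrow> 'k ab_term \<Rightarrow> 'k ab_term"
  where "Minus t s \<equiv> Plus t (Scale (-1) s)"

inductive ab_eq :: "'k::field ab_term \<Rightarrow> 'k ab_term \<Rightarrow> bool" where
  \<comment> \<open>congruence on well-typed expressions\<close>
  refl: "ab_typed t m n \<Longrightarrow> ab_eq t t"
| sym: "ab_eq t s \<Longrightarrow> ab_eq s t"
| trans: "ab_eq t s \<Longrightarrow> ab_eq s r \<Longrightarrow> ab_eq t r"
| Cmp_cong: "ab_typed (Cmp s t) m n \<Longrightarrow> ab_eq s s' \<Longrightarrow> ab_eq t t' \<Longrightarrow> ab_eq (Cmp s t) (Cmp s' t')"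
| Tens_cong: "ab_eq s s' \<Longrightarrow> ab_eq t t' \<Longrightarrow> ab_eq (Tens s t) (Tens s' t')"
| Plus_cong: "ab_typed (Plus s t) m n \<Longrightarrow> ab_eq s s' \<Longrightarrow> ab_eq t t' \<Longrightarrow> ab_eq (Plus s t) (Plus s' t')"
| Scale_cong: "ab_eq t t' \<Longrightarrow> ab_eq (Scale a t) (Scale a t')"
  \<comment> \<open>vector spaces\<close>
| Plus_assoc: "ab_typed (Plus (Plus r s) t) m n \<Longrightarrow>
    ab_eq (Plus (Plus r s) t) (Plus r (Plus s t))"
| Plus_commute: "ab_typed (Plus s t) m n \<Longrightarrow> ab_eq (Plus s t) (Plus t s)"
| Plus_Zero: "ab_typed t m n \<Longrightarrow> ab_eq (Plus t (Zero m n)) t"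
| Minus_self: "ab_typed t m n \<Longrightarrow> ab_eq (Minus t t) (Zero m n)"
| Scale_Plus: "ab_typed (Plus s t) m n \<Longrightarrow>
    ab_eq (Scale a (Plus s t)) (Plus (Scale a s) (Scale a t))"
| Scale_add: "ab_typed t m n \<Longrightarrow> ab_eq (Scale (a + b) t) (Plus (Scale a t) (Scale b t))"
| Scale_mult: "ab_typed t m n \<Longrightarrow> ab_eq (Scale (a * b) t) (Scale a (Scale b t))"
| Scale_one: "ab_typed t m n \<Longrightarrow> ab_eq (Scale 1 t) t"
  \<comment> \<open>linear category\<close>
| Idt_left: "ab_typed t m n \<Longrightarrow> ab_eq (Cmp (Idt n) t) t"
| Idt_right: "ab_typed t m n \<Longrightarrow> ab_eq (Cmp t (Idt m)) t"
| Cmp_assoc: "ab_typed (Cmp (Cmp r s) t) m n \<Longrightarrow>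
    ab_eq (Cmp (Cmp r s) t) (Cmp r (Cmp s t))"
| Cmp_Plus_left: "ab_typed (Cmp (Plus r s) t) m n \<Longrightarrow>
    ab_eq (Cmp (Plus r s) t) (Plus (Cmp r t) (Cmp s t))"
| Cmp_Plus_right: "ab_typed (Cmp r (Plus s t)) m n \<Longrightarrow>
    ab_eq (Cmp r (Plus s t)) (Plus (Cmp r s) (Cmp r t))"
| Cmp_Scale_left: "ab_typed (Cmp s t) m n \<Longrightarrow>
    ab_eq (Cmp (Scale a s) t) (Scale a (Cmp s t))"
| Cmp_Scale_right: "ab_typed (Cmp s t) m n \<Longrightarrow>
    ab_eq (Cmp s (Scale a t)) (Scale a (Cmp s t))"
  \<comment> \<open>strict linear monoidal category\<close>
| Tens_Plus_left: "ab_typed (Tens (Plus r s) t) m n \<Longrightarrow>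
    ab_eq (Tens (Plus r s) t) (Plus (Tens r t) (Tens s t))"
| Tens_Plus_right: "ab_typed (Tens r (Plus s t)) m n \<Longrightarrow>
    ab_eq (Tens r (Plus s t)) (Plus (Tens r s) (Tens r t))"
| Tens_Scale_left: "ab_typed (Tens s t) m n \<Longrightarrow>
    ab_eq (Tens (Scale a s) t) (Scale a (Tens s t))"
| Tens_Scale_right: "ab_typed (Tens s t) m n \<Longrightarrow>
    ab_eq (Tens s (Scale a t)) (Scale a (Tens s t))"
| Tens_Idt: "ab_eq (Tens (Idt m) (Idt n)) (Idt (m + n))"
| interchange: "ab_typed (Cmp s t) l n \<Longrightarrow> ab_typed (Cmp s' t') l' n' \<Longrightarrow>
    ab_eq (Tens (Cmp s t) (Cmp s' t')) (Cmp (Tens s s') (Tens t t'))"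
| Tens_assoc: "ab_typed (Tens (Tens r s) t) m n \<Longrightarrow>
    ab_eq (Tens (Tens r s) t) (Tens r (Tens s t))"
| Tens_unit_left: "ab_typed t m n \<Longrightarrow> ab_eq (Tens (Idt 0) t) t"
| Tens_unit_right: "ab_typed t m n \<Longrightarrow> ab_eq (Tens t (Idt 0)) t"
  \<comment> \<open>defining relations\<close>
| Swap_Swap: "ab_eq (Cmp Swap Swap) (Idt 2)"
| braid: "ab_eq
    (Cmp (Tens Swap (Idt 1)) (Cmp (Tens (Idt 1) Swap) (Tens Swap (Idt 1))))
    (Cmp (Tens (Idt 1) Swap) (Cmp (Tens Swap (Idt 1)) (Tens (Idt 1) Swap)))"
| zigzag_left: "ab_eq (Cmp (Tens (Idt 1) Cap) (Tens Cup (Idt 1))) (Idt 1)"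
| zigzag_right: "ab_eq (Cmp (Tens Cap (Idt 1)) (Tens (Idt 1) Cup)) (Idt 1)"
| Cap_Swap: "ab_eq (Cmp Cap Swap) Cap"
| Cap_slide: "ab_eq
    (Cmp (Tens (Idt 1) Cap) (Tens Swap (Idt 1)))
    (Cmp (Tens Cap (Idt 1)) (Tens (Idt 1) Swap))"
| Dot_Swap: "ab_eq
    (Minus (Cmp (Tens Dot (Idt 1)) Swap) (Cmp Swap (Tens (Idt 1) Dot)))
    (Minus (Idt 2) (Cmp Cup Cap))"
| Cap_Dot: "ab_eq (Cmp Cap (Tens Dot (Idt 1))) (Scale (-1) (Cmp Cap (Tens (Idt 1) Dot)))"

type_synonym 'k ab_mor = "'k ab_term set"

definition ab_class :: "'k::field ab_term \<Rightarrow> 'k ab_mor"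
  where "ab_class t = {t'. ab_eq t t'}"

text \<open>
  Operations on equivalence classes are unions over all representatives, as in
  \<^theory>\<open>HOL.Equiv_Relations\<close>.
\<close>

definition AB :: "(nat, 'k::field ab_mor, 'k) moncat"
  where "AB = \<lparr>
    Ob = UNIV,
    Hom = (\<lambda>m n. mk_module
      {ab_class t | t. ab_typed t m n}
      (ab_class (Zero m n))
      (\<lambda>f g. \<Union>t\<in>f. \<Union>s\<in>g. ab_class (Plus t s))
      (\<lambda>a f. \<Union>t\<in>f. ab_class (Scale a t))),
    ident = (\<lambda>n. ab_class (Idt n)),
    cmp = (\<lambda>g f. \<Union>s\<in>g. \<Union>t\<in>f. ab_class (Cmp s t)),
    unit_ob = 0,
    tens_ob = (+),
    tens_mor = (\<lambda>f g. \<Union>t\<in>f. \<Union>s\<in>g. ab_class (Tens t s))\<rparr>"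

fun cat_power :: "('o, 'm, 'k, 'z) lincat_scheme \<Rightarrow> 'o \<Rightarrow> 'm \<Rightarrow> nat \<Rightarrow> 'm"
  where
    "cat_power C X f 0 = ident C X"
  | "cat_power C X f (Suc n) = cmp C f (cat_power C X f n)"

definition cat_poly ::
  "('o, 'm, 'k::field, 'z) lincat_scheme \<Rightarrow> 'o \<Rightarrow> 'm \<Rightarrow> 'k poly \<Rightarrow> 'm"
  where "cat_poly C X f p =
    finsum (Hom C X X)
      (\<lambda>i. Polynomial.coeff p i \<odot>\<^bsub>Hom C X X\<^esub> cat_power C X f i) {..Polynomial.degree p}"

definition bubble :: "nat \<Rightarrow> 'k::field ab_mor"
  where "bubble n =
    cmp AB (ab_class Cap)
      (cmp AB (tens_mor AB (ident AB 1) (cat_power AB 1 (ab_class Dot) n)) (ab_class Cup))"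

text \<open>
  Laurent series in \<open>u\<^sup>-\<^sup>1\<close> are modelled by formal Laurent series in the formal variable
  \<^const>\<open>fls_X\<close>, which stands for \<open>u\<^sup>-\<^sup>1\<close>. So \<open>u\<close> is \<^const>\<open>fls_X_inv\<close>, the coefficient of \<open>u\<^sup>-\<^sup>n\<close> is
  the one of index \<open>n\<close>, and expanding a rational function at \<open>u = \<infinity>\<close> amounts to
  evaluating it in the field of formal Laurent series.
\<close>

abbreviation uu :: "'k::field fls" where "uu \<equiv> fls_X_inv"

text \<open>The coefficient of \<open>u\<^sup>-\<^sup>n\<close> in \<open>\<beta>\<^sub>r(u)\<close>.\<close>

definition beta_r :: "nat \<Rightarrow> 'k::field ab_mor"
  where "beta_r n =
    (if n = 0 then ident AB 0 else zero_mor AB 0 0) \<oplus>\<^bsub>Hom AB 0 0\<^esub>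
    finsum (Hom AB 0 0)
      (\<lambda>j. fls_nth (2 * uu / (2 * uu - 1)) (int (n - 1 - j)) \<odot>\<^bsub>Hom AB 0 0\<^esub> bubble j) {..<n}"

section \<open>Module categories over the affine Brauer category\<close>

locale AB_module_category =
  linear_category R + strict_monoidal_functor AB "End_cat R" \<Phi>
  for R :: "('o, 'm, 'k::field) lincat"
    and \<Phi> :: "(nat, 'k ab_mor, ('o, 'm) endofun, ('o, 'm) nattrans) lfunctor"

definition act_ob ::
  "(nat, 'k ab_mor, ('o, 'm) endofun, ('o, 'm) nattrans) lfunctor \<Rightarrow> nat \<Rightarrow> 'o \<Rightarrow> 'o"
  where "act_ob \<Phi> n L = fob (fob \<Phi> n) L"

definition act_mor ::
  "(nat, 'k ab_mor, ('o, 'm) endofun, ('o, 'm) nattrans) lfunctor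
    \<Rightarrow> 'k ab_mor \<Rightarrow> 'o \<Rightarrow> 'm"
  where "act_mor \<Phi> f L = (case fmor \<Phi> f of (_, \<alpha>, _) \<Rightarrow> \<alpha> L)"

definition brick :: "('o, 'm, 'k::field, 'z) lincat_scheme \<Rightarrow> 'o \<Rightarrow> bool"
  where "brick C L \<longleftrightarrow>
    L \<in> Ob C \<and> bij_betw (\<lambda>c. c \<odot>\<^bsub>Hom C L L\<^esub> ident C L) UNIV (Arr C L L)"

text \<open>The kernel of the evaluation homomorphism \<open>f(u) \<mapsto> f(x)\<^sub>L\<close>.\<close>

definition dot_ideal ::
  "('o, 'm, 'k::field) lincat \<Rightarrow> (nat, 'k ab_mor, ('o, 'm) endofun, ('o, 'm) nattrans) lfunctor
    \<Rightarrow> 'o \<Rightarrow> 'k poly set"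
  where "dot_ideal R \<Phi> L =
    {f. act_mor \<Phi> (cat_poly AB 1 (ab_class Dot) f) L
          = zero_mor R (act_ob \<Phi> 1 L) (act_ob \<Phi> 1 L)}"

definition is_dot_minpoly ::
  "('o, 'm, 'k::field) lincat \<Rightarrow> (nat, 'k ab_mor, ('o, 'm) endofun, ('o, 'm) nattrans) lfunctor
    \<Rightarrow> 'o \<Rightarrow> 'k poly \<Rightarrow> bool"
  where "is_dot_minpoly R \<Phi> L m \<longleftrightarrow>
    lead_coeff m = 1 \<and> dot_ideal R \<Phi> L = {f. m dvd f}"

text \<open>
  The series by which \<open>\<beta>\<^sub>r(u)\<close> acts on a brick \<open>L\<close>: each coefficient acts by a unique
  scalar.
\<close>

definition O_series ::
  "('o, 'm, 'k::field) lincat \<Rightarrow> (nat, 'k ab_mor, ('o, 'm) endofun, ('o, 'm) nattrans) lfunctor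
    \<Rightarrow> 'o \<Rightarrow> 'k fps"
  where "O_series R \<Phi> L =
    Abs_fps (\<lambda>n. THE c. act_mor \<Phi> (beta_r n) L = c \<odot>\<^bsub>Hom R L L\<^esub> ident R L)"

definition eval_at :: "'k::field poly \<Rightarrow> 'k fls \<Rightarrow> 'k fls"
  where "eval_at f z = poly (map_poly fls_const f) z"

definition O_rational :: "'k::field poly \<Rightarrow> 'k fls"
  where "O_rational f =
    (((-1) ^ Polynomial.degree f * uu - 1/2) * eval_at f (- uu))
      / ((uu - 1/2) * eval_at f uu)"

section \<open>Locally finite abelian categories\<close>

definition zero_object :: "('o, 'm, 'k, 'z) lincat_scheme \<Rightarrow> 'o \<Rightarrow> bool"
  where "zero_object C Z \<longleftrightarrow>
    Z \<in> Ob C \<and> (\<forall>X\<in>Ob C. (\<exists>!f. f \<in> Arr C Z X) \<and> (\<exists>!f. f \<in> Arr C X Z))"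

definition is_product ::
  "('o, 'm, 'k, 'z) lincat_scheme \<Rightarrow> 'o \<Rightarrow> 'o \<Rightarrow> 'o \<Rightarrow> 'm \<Rightarrow> 'm \<Rightarrow> bool"
  where "is_product C X Y P p q \<longleftrightarrow>
    P \<in> Ob C \<and> p \<in> Arr C P X \<and> q \<in> Arr C P Y \<and>
    (\<forall>Z\<in>Ob C. \<forall>f\<in>Arr C Z X. \<forall>g\<in>Arr C Z Y.
      \<exists>!h. h \<in> Arr C Z P \<and> cmp C p h = f \<and> cmp C q h = g)"

definition is_mono :: "('o, 'm, 'k, 'z) lincat_scheme \<Rightarrow> 'o \<Rightarrow> 'o \<Rightarrow> 'm \<Rightarrow> bool"
  where "is_mono C X Y f \<longleftrightarrow>
    f \<in> Arr C X Y \<and>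
    (\<forall>Z\<in>Ob C. \<forall>g\<in>Arr C Z X. \<forall>h\<in>Arr C Z X. cmp C f g = cmp C f h \<longrightarrow> g = h)"

definition is_epi :: "('o, 'm, 'k, 'z) lincat_scheme \<Rightarrow> 'o \<Rightarrow> 'o \<Rightarrow> 'm \<Rightarrow> bool"
  where "is_epi C X Y f \<longleftrightarrow>
    f \<in> Arr C X Y \<and>
    (\<forall>Z\<in>Ob C. \<forall>g\<in>Arr C Y Z. \<forall>h\<in>Arr C Y Z. cmp C g f = cmp C h f \<longrightarrow> g = h)"

text \<open>\<open>k : K \<rightarrow> X\<close> is a kernel of \<open>f : X \<rightarrow> Y\<close>.\<close>

definition is_kernel ::
  "('o, 'm, 'k, 'z) lincat_scheme \<Rightarrow> 'o \<Rightarrow> 'o \<Rightarrow> 'o \<Rightarrow> 'm \<Rightarrow> 'm \<Rightarrow> bool"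
  where "is_kernel C K X Y k f \<longleftrightarrow>
    k \<in> Arr C K X \<and> cmp C f k = zero_mor C K Y \<and>
    (\<forall>Z\<in>Ob C. \<forall>g\<in>Arr C Z X. cmp C f g = zero_mor C Z Y \<longrightarrow>
      (\<exists>!h. h \<in> Arr C Z K \<and> cmp C k h = g))"

text \<open>\<open>q : Y \<rightarrow> Q\<close> is a cokernel of \<open>f : X \<rightarrow> Y\<close>.\<close>

definition is_cokernel ::
  "('o, 'm, 'k, 'z) lincat_scheme \<Rightarrow> 'o \<Rightarrow> 'o \<Rightarrow> 'o \<Rightarrow> 'm \<Rightarrow> 'm \<Rightarrow> bool"
  where "is_cokernel C X Y Q f q \<longleftrightarrow>
    q \<in> Arr C Y Q \<and> cmp C q f = zero_mor C X Q \<and>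
    (\<forall>Z\<in>Ob C. \<forall>g\<in>Arr C Y Z. cmp C g f = zero_mor C X Z \<longrightarrow>
      (\<exists>!h. h \<in> Arr C Q Z \<and> cmp C h q = g))"

locale abelian_category = linear_category C
  for C :: "('o, 'm, 'k::field, 'z) lincat_scheme" +
  assumes has_zero: "\<exists>Z. zero_object C Z"
    and has_products: "\<lbrakk>X \<in> Ob C; Y \<in> Ob C\<rbrakk> \<Longrightarrow> \<exists>P p q. is_product C X Y P p q"
    and has_kernels:
      "\<lbrakk>X \<in> Ob C; Y \<in> Ob C; f \<in> Arr C X Y\<rbrakk> \<Longrightarrow> \<exists>K\<in>Ob C. \<exists>k. is_kernel C K X Y k f"
    and has_cokernels:
      "\<lbrakk>X \<in> Ob C; Y \<in> Ob C; f \<in> Arr C X Y\<rbrakk> \<Longrightarrow> \<exists>Q\<in>Ob C. \<exists>q. is_cokernel C X Y Q f q"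
    and mono_normal:
      "\<lbrakk>X \<in> Ob C; Y \<in> Ob C; is_mono C X Y f\<rbrakk>
        \<Longrightarrow> \<exists>Z\<in>Ob C. \<exists>g\<in>Arr C Y Z. is_kernel C X Y Z f g"
    and epi_normal:
      "\<lbrakk>X \<in> Ob C; Y \<in> Ob C; is_epi C X Y f\<rbrakk>
        \<Longrightarrow> \<exists>Z\<in>Ob C. \<exists>g\<in>Arr C Z X. is_cokernel C Z X Y g f"

definition simple_object :: "('o, 'm, 'k, 'z) lincat_scheme \<Rightarrow> 'o \<Rightarrow> bool"
  where "simple_object C S \<longleftrightarrow>
    S \<in> Ob C \<and> \<not> zero_object C S \<and>
    (\<forall>X\<in>Ob C. \<forall>i. is_mono C X S i \<longrightarrow> i = zero_mor C X S \<or> is_iso C X S i)"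

text \<open>Existence of a composition series, built from the bottom.\<close>

inductive finite_length :: "('o, 'm, 'k, 'z) lincat_scheme \<Rightarrow> 'o \<Rightarrow> bool"
  for C :: "('o, 'm, 'k, 'z) lincat_scheme"
  where
    zero: "zero_object C Z \<Longrightarrow> finite_length C Z"
  | extend: "\<lbrakk>finite_length C Y; X \<in> Ob C; simple_object C S;
      is_kernel C Y X S i p; is_cokernel C Y X S i p\<rbrakk> \<Longrightarrow> finite_length C X"

definition locally_finite_abelian :: "('o, 'm, 'k::field, 'z) lincat_scheme \<Rightarrow> bool"
  where "locally_finite_abelian C \<longleftrightarrow>
    abelian_category C \<and> (\<forall>X\<in>Ob C. finite_length C X) \<and>
    (\<forall>X\<in>Ob C. \<forall>Y\<in>Ob C. finite_dim_subspace (Hom C X Y) (Arr C X Y))"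

section \<open>Schurian categories\<close>

text \<open>
  An algebra is given by a module record whose field \<open>mult\<close> is the multiplication; there is
  no unit, but a set \<open>E\<close> of mutually orthogonal idempotents. The axiom \<open>local_unit\<close> says
  that the algebra is the sum of the subspaces \<open>e A f\<close> for \<open>e, f \<in> E\<close>, which is direct by
  orthogonality.
\<close>

locale locally_unital_algebra =
  fixes A :: "('k::field, 'a) module" (structure) and E :: "'a set"
  assumes vector_space: "vector_space_over_k A"
    and mult_linear_left: "y \<in> carrier A \<Longrightarrow> linear_map A A (\<lambda>x. x \<otimes> y)"
    and mult_linear_right: "x \<in> carrier A \<Longrightarrow> linear_map A A (\<lambda>y. x \<otimes> y)"
    and mult_assoc:
      "\<lbrakk>x \<in> carrier A; y \<in> carrier A; z \<in> carrier A\<rbrakk> \<Longrightarrow> (x \<otimes> y) \<otimes> z = x \<otimes> (y \<otimes> z)"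
    and idempotents_subset: "E \<subseteq> carrier A"
    and idempotent: "e \<in> E \<Longrightarrow> e \<otimes> e = e"
    and orthogonal: "\<lbrakk>e \<in> E; f \<in> E; e \<noteq> f\<rbrakk> \<Longrightarrow> e \<otimes> f = \<zero>"
    and local_unit:
      "x \<in> carrier A \<Longrightarrow>
        \<exists>F. finite F \<and> F \<subseteq> E \<and> x = (\<Oplus>e\<in>F. \<Oplus>f\<in>F. e \<otimes> x \<otimes> f)"

definition locally_finite_dim_algebra :: "('k::field, 'a) module \<Rightarrow> 'a set \<Rightarrow> bool"
  where "locally_finite_dim_algebra A E \<longleftrightarrow>
    locally_unital_algebra A E \<and>
    (\<forall>e\<in>E. \<forall>f\<in>E. finite_dim_subspace A ((\<lambda>x. e \<otimes>\<^bsub>A\<^esub> x \<otimes>\<^bsub>A\<^esub> f) ` carrier A))"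

record ('k, 'v, 'a) lmod = "('k, 'v) module" +
  act :: "'a \<Rightarrow> 'v \<Rightarrow> 'v"

text \<open>Left modules \<open>V\<close> such that \<open>V\<close> is the sum (necessarily direct) of the \<open>e V\<close> for \<open>e \<in> E\<close>,
  each of which is finite-dimensional.\<close>

locale locally_finite_dim_module =
  fixes A :: "('k::field, 'a) module" and E :: "'a set" and V :: "('k, 'v, 'a) lmod"
  assumes module_vector_space: "vector_space_over_k V"
    and act_linear_left: "v \<in> carrier V \<Longrightarrow> linear_map A V (\<lambda>x. act V x v)"
    and act_linear_right: "x \<in> carrier A \<Longrightarrow> linear_map V V (\<lambda>v. act V x v)"
    and act_mult:
      "\<lbrakk>x \<in> carrier A; y \<in> carrier A; v \<in> carrier V\<rbrakk>
        \<Longrightarrow> act V (x \<otimes>\<^bsub>A\<^esub> y) v = act V x (act V y v)"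
    and module_local_unit:
      "v \<in> carrier V \<Longrightarrow> \<exists>F. finite F \<and> F \<subseteq> E \<and> v = (\<Oplus>\<^bsub>V\<^esub>e\<in>F. act V e v)"
    and locally_finite_dim: "e \<in> E \<Longrightarrow> finite_dim_subspace V (act V e ` carrier V)"

type_synonym ('k, 'v, 'a) lmod_hom =
  "('k, 'v, 'a) lmod \<times> ('v \<Rightarrow> 'v) \<times> ('k, 'v, 'a) lmod"

definition lfd_module_cat ::
  "('k::field, 'a) module \<Rightarrow> 'a set
    \<Rightarrow> (('k, 'v, 'a) lmod, ('k, 'v, 'a) lmod_hom, 'k) lincat"
  where "lfd_module_cat A E = \<lparr>
    Ob = {V. locally_finite_dim_module A E V},
    Hom = (\<lambda>V W. mk_module
      {(V, f, W) | f. linear_map V W f \<and> f \<in> extensional (carrier V) \<and>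
        (\<forall>x\<in>carrier A. \<forall>v\<in>carrier V. f (act V x v) = act W x (f v))}
      (V, (\<lambda>v\<in>carrier V. \<zero>\<^bsub>W\<^esub>), W)
      (\<lambda>(_, f, _) (_, g, _). (V, (\<lambda>v\<in>carrier V. f v \<oplus>\<^bsub>W\<^esub> g v), W))
      (\<lambda>a (_, f, _). (V, (\<lambda>v\<in>carrier V. a \<odot>\<^bsub>W\<^esub> f v), W))),
    ident = (\<lambda>V. (V, (\<lambda>v\<in>carrier V. v), V)),
    cmp = (\<lambda>(_, g, W) (V, f, _). (V, (\<lambda>v\<in>carrier V. g (f v)), W))\<rparr>"

text \<open>
  Modules must live on a fixed type. A locally finite-dimensional module is isomorphic, as a
  vector space, to the space of finitely supported functions on a subset of \<open>E \<times> \<nat>\<close>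
  (choose a basis of each \<open>e V\<close>), so every such module has an isomorphic copy whose
  carrier is a set of functions \<open>'a \<times> nat \<Rightarrow> 'k\<close>. The type \<open>'a\<close> of the algebra is
  a parameter of the predicate.
\<close>

definition schurian :: "'a itself \<Rightarrow> ('o, 'm, 'k::field) lincat \<Rightarrow> bool"
  where "schurian _ C \<longleftrightarrow>
    linear_category C \<and>
    (\<exists>(A :: ('k, 'a) module) E. locally_finite_dim_algebra A E \<and>
      linearly_equivalent C
        (lfd_module_cat A E ::
          (('k, 'a \<times> nat \<Rightarrow> 'k, 'a) lmod, ('k, 'a \<times> nat \<Rightarrow> 'k, 'a) lmod_hom, 'k) lincat))"

end

theory Submission
  imports Defs
begin

text \<open>
  Let \<open>F\<close> be the endofunctor attached to \<open>B\<close> and let \<open>x\<close> be the dot on \<open>F L\<close>. An endomorphism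
  \<open>h\<close> of \<open>F L\<close>, for instance \<open>f(x)\<close>, can also be put on a closed bubble to the left of \<open>L\<close>, or
  on the loop of a curl in the strand \<open>F\<close>, the loop lying next to \<open>L\<close>. Both operations are
  linear in \<open>h\<close>, so both kill \<open>m(x)\<close> for the minimal polynomial \<open>m\<close> of \<open>x\<close>. These two vanishing
  statements determine the series.

  For the bubbles, with values \<open>b\<^sub>n\<close>, the vanishing holds for all multiples of \<open>m\<close>; it says that
  \<open>b(u) = \<Sum>\<^sub>n b\<^sub>n u\<^sup>-\<^sup>n\<^sup>-\<^sup>1\<close> becomes a polynomial after multiplication by \<open>m(u)\<close>.

  For the curls, sliding a dot through the crossing gives
  \<open>curl(x h) = F(bubble(h)) - curl(h) x - h\<close> (\<open>curl_dot\<close>), and \<open>curl(1) = 1\<close> (\<open>curl_ident\<close>).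
  Hence \<open>curl(f(x)) = c\<^sub>f(x)\<close> for an explicit polynomial \<open>c\<^sub>f\<close> (\<open>curl_cat_poly\<close>), which has the
  degree \<open>d\<close> of \<open>f\<close> and leading coefficient \<open>(-1)\<^sup>d\<close> times that of \<open>f\<close>. As \<open>c\<^sub>m(x) = 0\<close>, the
  monic polynomial \<open>m\<close> divides \<open>c\<^sub>m\<close>, and comparing degrees gives \<open>c\<^sub>m = (-1)\<^sup>d m\<close>.

  On the other hand, the same recurrence and the vanishing of the bubbles express \<open>c\<^sub>m(-u)\<close>
  through \<open>b(u)\<close> (\<open>curl_poly_eval\<close>):
  \<open>2u c\<^sub>m(-u) = 2u m(u) (1 + b(u)) + m(-u) - m(u)\<close>.
  Inserting \<open>c\<^sub>m = (-1)\<^sup>d m\<close> gives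
  \<open>(2u - 1 + 2u b(u)) m(u) = (2(-1)\<^sup>d u - 1) m(-u)\<close>, and division by \<open>(2u - 1) m(u)\<close> is
  the claim, because \<open>\<beta>\<^sub>r(u)\<close> acts on \<open>L\<close> by \<open>1 + 2u/(2u-1) b(u)\<close>.
\<close>

section \<open>The curl recurrence for polynomials\<close>

text \<open>
  The linear functional on polynomials that sends \<open>t\<^sup>i\<close> to \<open>b i\<close>. If \<open>b i\<close> is the value of the
  bubble with \<open>i\<close> dots, it gives the value of the bubble decorated with a polynomial.
\<close>

definition moment_functional :: "(nat \<Rightarrow> 'k::field) \<Rightarrow> 'k poly \<Rightarrow> 'k"
  where "moment_functional b f = (\<Sum>i\<le>Polynomial.degree f. Polynomial.coeff f i * b i)"

text \<open>
  Sums over the coefficients of a polynomial are handled by peeling off the constant coefficient,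
  so that all later arguments are inductions along \<^const>\<open>pCons\<close>.
\<close>

lemma sum_coeff_pCons:
  fixes g :: "'a::comm_monoid_add \<Rightarrow> nat \<Rightarrow> 'b::comm_monoid_add"
  assumes "\<And>i. g 0 i = 0"
  shows "(\<Sum>i\<le>Polynomial.degree (pCons a p). g (Polynomial.coeff (pCons a p) i) i)
    = g a 0 + (\<Sum>i\<le>Polynomial.degree p. g (Polynomial.coeff p i) (Suc i))"
  using assms
  by (cases "p = 0") (simp_all add: sum.atMost_Suc_shift del: sum.atMost_Suc)

lemma moment_functional_0 [simp]: "moment_functional b 0 = 0"
  by (simp add: moment_functional_def)

lemma moment_functional_pCons:
  "moment_functional b (pCons a p) = a * b 0 + moment_functional (\<lambda>i. b (Suc i)) p"
  unfolding moment_functional_def by (rule sum_coeff_pCons) simp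

lemma moment_functional_shift:
  "moment_functional (\<lambda>i. b (i + k)) f = moment_functional b (Polynomial.monom 1 k * f)"
proof (induction k arbitrary: b)
  case 0
  show ?case by simp
next
  case (Suc k)
  then show ?case
    using Suc.IH [of "\<lambda>i. b (Suc i)"] by (simp add: monom_Suc moment_functional_pCons)
qed

text \<open>
  The polynomial in the dot on the through strand to which the curl with \<open>n\<close> dots on its loop
  reduces, if the bubble with \<open>i\<close> dots has the value \<open>b i\<close>. In the recursion one of the dots
  passes the crossing: it ends up with the opposite sign on the strand, and the two correction
  terms turn the loop into a separate bubble or straighten it into the strand.
\<close>

fun curl_monomial :: "(nat \<Rightarrow> 'k::field) \<Rightarrow> nat \<Rightarrow> 'k poly"
  where
    "curl_monomial b 0 = 1"
  | "curl_monomial b (Suc n) = [:b n:] - pCons 0 (curl_monomial b n) - Polynomial.monom 1 n"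

definition curl_poly :: "(nat \<Rightarrow> 'k::field) \<Rightarrow> 'k poly \<Rightarrow> 'k poly"
  where "curl_poly b f =
    (\<Sum>i\<le>Polynomial.degree f. Polynomial.smult (Polynomial.coeff f i) (curl_monomial b i))"

lemma curl_poly_0 [simp]: "curl_poly b 0 = 0"
  by (simp add: curl_poly_def)

lemma pCons_0_sum: "pCons 0 (sum f A) = (\<Sum>i\<in>A. pCons 0 (f i))"
  by (induction A rule: infinite_finite_induct) (simp_all, metis add_pCons add_0)

lemma const_poly_sum: "[:sum f A:] = (\<Sum>i\<in>A. [:f i:])"
  by (induction A rule: infinite_finite_induct) (simp_all, metis add_pCons add_0)

text \<open>The recursion of \<^const>\<open>curl_monomial\<close>, extended linearly.\<close>

lemma curl_poly_pCons:
  "curl_poly b (pCons a p) = [:a + moment_functional b p:] - pCons 0 (curl_poly b p) - p"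
proof -
  have "curl_poly b (pCons a p) = Polynomial.smult a 1 +
      (\<Sum>i\<le>Polynomial.degree p.
        Polynomial.smult (Polynomial.coeff p i) (curl_monomial b (Suc i)))"
    unfolding curl_poly_def by (subst sum_coeff_pCons) simp_all
  also have "(\<Sum>i\<le>Polynomial.degree p.
        Polynomial.smult (Polynomial.coeff p i) (curl_monomial b (Suc i)))
      = [:moment_functional b p:] - pCons 0 (curl_poly b p)
        - (\<Sum>i\<le>Polynomial.degree p. Polynomial.monom (Polynomial.coeff p i) i)"
    unfolding moment_functional_def curl_poly_def pCons_0_sum const_poly_sum sum_subtractf [symmetric]
    by (intro sum.cong [OF HOL.refl] poly_eqI)
       (simp add: coeff_pCons algebra_simps del: diff_pCons split: nat.split)
  also have "(\<Sum>i\<le>Polynomial.degree p. Polynomial.monom (Polynomial.coeff p i) i) = p"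
    by (rule poly_as_sum_of_monoms)
  finally show ?thesis
    by (simp add: one_pCons)
qed

text \<open>
  The degree grows only through the term \<open>- t c\<close> of the recursion, and each such step changes
  the sign of the leading coefficient.
\<close>

lemma curl_poly_leading:
  "Polynomial.degree (curl_poly b f) \<le> Polynomial.degree f \<and>
   Polynomial.coeff (curl_poly b f) (Polynomial.degree f)
     = (-1) ^ Polynomial.degree f * Polynomial.lead_coeff f"
proof (induction f)
  case 0
  show ?case by simp
next
  case (pCons a p)
  show ?case
  proof (cases "p = 0")
    case True
    then show ?thesis by (simp add: curl_poly_pCons)
  next
    case False
    have "Polynomial.degree (pCons 0 (curl_poly b p)) \<le> Suc (Polynomial.degree p)"
      using pCons.IH by (meson Suc_le_mono degree_pCons_le order_trans)
    then have "Polynomial.degree ([:a + moment_functional b p:] - pCons 0 (curl_poly b p) - p)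
        \<le> Suc (Polynomial.degree p)"
      by (intro degree_diff_le) simp_all
    with pCons.IH False show ?thesis
      by (simp add: curl_poly_pCons coeff_eq_0 del: coeff_0)
  qed
qed

lemma dvd_curl_poly_imp_eq:
  assumes "Polynomial.lead_coeff m = 1" and "m dvd curl_poly b m"
  shows "curl_poly b m = Polynomial.smult ((-1) ^ Polynomial.degree m) m"
proof -
  obtain h where h: "curl_poly b m = m * h" using assms(2) by (rule dvdE)
  have m0: "m \<noteq> 0" using assms(1) by auto
  have lead: "Polynomial.coeff (curl_poly b m) (Polynomial.degree m) = (-1) ^ Polynomial.degree m"
    and deg: "Polynomial.degree (curl_poly b m) \<le> Polynomial.degree m"
    using curl_poly_leading[of b m] assms(1) by simp_all
  have "h \<noteq> 0" using lead h by auto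
  then have "Polynomial.degree h = 0" using deg h m0 by (simp add: degree_mult_eq)
  then obtain a where a: "h = [:a:]" by (rule degree_eq_zeroE)
  have "a = (-1) ^ Polynomial.degree m" using lead assms(1) by (simp add: h a)
  then show ?thesis by (simp add: h a)
qed

lemma eval_at_0 [simp]: "eval_at 0 z = 0"
  by (simp add: eval_at_def)

lemma eval_at_pCons [simp]: "eval_at (pCons a p) z = fls_const a + z * eval_at p z"
  by (simp add: eval_at_def map_poly_pCons)

lemma eval_at_add [simp]: "eval_at (p + q) z = eval_at p z + eval_at q z"
  by (induction p q rule: poly_induct2) (simp_all add: algebra_simps flip: fls_plus_const)

lemma eval_at_diff [simp]: "eval_at (p - q) z = eval_at p z - eval_at q z"
  using eval_at_add [of "p - q" q z] by simp

lemma eval_at_smult: "eval_at (Polynomial.smult a p) z = fls_const a * eval_at p z"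
  by (induction p) (simp_all add: algebra_simps fls_const_mult_const)

text \<open>
  The part of \<open>f(u) \<cdot> \<Sum>\<^sub>n b n u\<^sup>-\<^sup>n\<^sup>-\<^sup>1\<close> that has only negative powers of \<open>u\<close>. For \<open>f = 1\<close> this is the
  series itself; it vanishes if and only if multiplication by \<open>f(u)\<close> turns the series into a
  polynomial.
\<close>

definition moment_series :: "(nat \<Rightarrow> 'k::field) \<Rightarrow> 'k poly \<Rightarrow> 'k fls"
  where "moment_series b f =
    fls_X * fps_to_fls (Abs_fps (\<lambda>k. moment_functional (\<lambda>i. b (i + k)) f))"

lemma moment_series_0 [simp]: "moment_series b 0 = 0"
  by (simp add: moment_series_def flip: fps_zero_def)

lemma moment_series_pCons:
  "moment_series b (pCons a p) =
    fls_const a * moment_series b 1 + uu * moment_series b p - fls_const (moment_functional b p)"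
proof -
  let ?T = "\<lambda>f. Abs_fps (\<lambda>k. moment_functional (\<lambda>i. b (i + k)) f)"
  have "fps_X * ?T (pCons a p)
      = fps_const a * (fps_X * ?T 1) + ?T p - fps_const (moment_functional b p)"
  proof (rule fps_ext)
    fix n
    show "fps_nth (fps_X * ?T (pCons a p)) n
      = fps_nth (fps_const a * (fps_X * ?T 1) + ?T p - fps_const (moment_functional b p)) n"
      by (cases n) (simp_all add: moment_functional_pCons one_pCons)
  qed
  then have "fps_to_fls (fps_X * ?T (pCons a p))
      = fps_to_fls (fps_const a * (fps_X * ?T 1) + ?T p - fps_const (moment_functional b p))"
    by simp
  moreover have "uu * (fls_X * fps_to_fls (?T p)) = fps_to_fls (?T p)"
    by (simp add: fls_X_inv_times_conv_shift fls_X_times_conv_shift)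
  ultimately show ?thesis
    unfolding moment_series_def by (simp add: fls_times_fps_to_fls)
qed

text \<open>
  The generating function form of the curl recurrence. At \<open>t = -u\<close> the term \<open>- t c\<close> of the
  recursion becomes \<open>u c\<close>, in step with the factor \<open>u\<close> that \<^const>\<open>pCons\<close> introduces in \<open>f(u)\<close> and in
  the moment series. The loops that straighten contribute the divided difference
  \<open>(f(u) - f(-u)) / 2u\<close>; the factor \<open>2u\<close> clears its denominator.
\<close>

lemma curl_poly_eval:
  fixes b :: "nat \<Rightarrow> 'k::field"
  shows "2 * uu * eval_at (curl_poly b f) (- uu) =
    2 * uu * (eval_at f uu * (1 + moment_series b 1) - moment_series b f)
      + eval_at f (- uu) - eval_at f uu"
proof (induction f)
  case 0
  show ?case by simp
next
  case (pCons a p)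
  let ?u = "uu :: 'k fls" and ?B = "moment_series b 1"
  have "2 * ?u * eval_at (curl_poly b (pCons a p)) (- ?u)
    = 2 * ?u * (fls_const a + fls_const (moment_functional b p))
      + ?u * (2 * ?u * eval_at (curl_poly b p) (- ?u)) - 2 * ?u * eval_at p (- ?u)"
    by (simp add: curl_poly_pCons algebra_simps del: diff_pCons add_pCons flip: fls_plus_const)
  also have "\<dots> = 2 * ?u * (fls_const a + fls_const (moment_functional b p))
      + ?u * (2 * ?u * (eval_at p ?u * (1 + ?B) - moment_series b p)
      + eval_at p (- ?u) - eval_at p ?u) - 2 * ?u * eval_at p (- ?u)"
    by (simp only: pCons.IH)
  also have "\<dots> = 2 * ?u * (eval_at (pCons a p) ?u * (1 + ?B) - moment_series b (pCons a p))
      + eval_at (pCons a p) (- ?u) - eval_at (pCons a p) ?u"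
    by (simp add: moment_series_pCons algebra_simps)
  finally show ?case .
qed

section \<open>Rational functions expanded at infinity\<close>

lemma two_neq_0_if_CHAR_neq_2:
  assumes "CHAR('k::field) \<noteq> 2"
  shows "(2::'k) \<noteq> 0"
proof
  assume "(2::'k) = 0"
  then have "CHAR('k) dvd 2"
    using of_nat_eq_0_iff_char_dvd [where 'a = 'k, of 2] by simp
  then show False
    using assms CHAR_not_1 [where 'a = 'k] dvd_imp_le [of "CHAR('k)" 2]
    by (cases "CHAR('k) = 0") (auto simp: le_Suc_eq numeral_2_eq_2)
qed

lemma fls_nth_eval_at_uu:
  "fls_nth (eval_at p uu) k = (if k \<le> 0 then Polynomial.coeff p (nat (- k)) else 0)"
proof (induction p arbitrary: k)
  case 0
  show ?case by simp
next
  case (pCons a p)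
  have "nat (- k) = Suc (nat (- (k + 1)))" if "k < 0"
    using that by simp
  then show ?case
    by (simp add: pCons.IH fls_X_inv_times_conv_shift)
qed

text \<open>Distinct powers of \<open>u\<close> are linearly independent, so a nonzero polynomial has nonzero value at \<open>u\<close>.\<close>

lemma eval_at_uu_neq_0: "p \<noteq> 0 \<Longrightarrow> eval_at p uu \<noteq> 0"
  using fls_nth_eval_at_uu [of p "- int (Polynomial.degree p)"]
  by (metis fls_zero_nth leading_coeff_0_iff minus_minus nat_int neg_le_0_iff_le of_nat_0_le_iff)

lemma two_uu_minus_1_neq_0: "2 * uu - 1 \<noteq> (0 :: 'k::field fls)"
proof -
  have "eval_at [:- 1, 2 :: 'k:] uu = 2 * uu - 1"
    by (simp add: mult.commute [of uu])
  moreover have "eval_at [:- 1, 2 :: 'k:] uu \<noteq> 0"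
    by (intro eval_at_uu_neq_0) simp
  ultimately show ?thesis
    by (simp only:) simp
qed

text \<open>
  The algebraic core. Divisibility forces \<open>curl_poly b m = (-1)\<^sup>d m\<close> with \<open>d\<close> the degree of \<open>m\<close>,
  and vanishing of the moment series removes the error term of \<open>curl_poly_eval\<close>; what is
  left is a linear equation for the series.
\<close>

lemma curl_divisibility_determines_series:
  fixes b :: "nat \<Rightarrow> 'k::field"
  assumes two: "(2::'k) \<noteq> 0"
    and monic: "Polynomial.lead_coeff m = 1"
    and curl: "m dvd curl_poly b m"
    and bubbles: "moment_series b m = 0"
  shows "1 + 2 * uu / (2 * uu - 1) * moment_series b 1 = O_rational m"
proof -
  define e :: "'k fls" where "e = (-1) ^ Polynomial.degree m"
  let ?u = "uu :: 'k fls" and ?B = "moment_series b 1"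
  have e_const: "fls_const ((-1) ^ Polynomial.degree m) = e"
    unfolding e_def by (metis fls_const_power fls_const_uminus fls_const_1)
  have m_neq_0: "eval_at m ?u \<noteq> 0"
    using monic by (intro eval_at_uu_neq_0) auto
  have two_fls: "(2 :: 'k fls) \<noteq> 0"
    using two by (metis fls_const_nonzero fls_const_numeral)
  have "2 * ?u * e * eval_at m (- ?u)
      = 2 * ?u * (eval_at m ?u * (1 + ?B)) + eval_at m (- ?u) - eval_at m ?u"
    using curl_poly_eval [of b m]
    by (simp add: dvd_curl_poly_imp_eq [OF monic curl] eval_at_smult e_const bubbles mult.assoc)
  then have *: "(2 * ?u - 1 + 2 * ?u * ?B) * eval_at m ?u = (2 * e * ?u - 1) * eval_at m (- ?u)"
    by (simp add: algebra_simps)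
  have "1 + 2 * ?u / (2 * ?u - 1) * ?B = (2 * ?u - 1 + 2 * ?u * ?B) / (2 * ?u - 1)"
    using two_uu_minus_1_neq_0 by (subst add_divide_distrib) simp
  also have "\<dots> = ((2 * e * ?u - 1) * eval_at m (- ?u)) / ((2 * ?u - 1) * eval_at m ?u)"
    using m_neq_0 by (simp flip: *)
  also have "\<dots> = O_rational m"
  proof -
    have "2 * e * ?u - 1 = 2 * (e * ?u - 1 / 2)" "2 * ?u - 1 = 2 * (?u - 1 / 2)"
      using two_fls by (simp_all add: right_diff_distrib)
    then show ?thesis
      unfolding O_rational_def e_def [symmetric] using two_fls by (simp only: mult.assoc) simp
  qed
  finally show ?thesis .
qed

text \<open>
  With \<open>v = u\<^sup>-\<^sup>1\<close> the quotient is \<open>1 / (1 - v/2)\<close>. That it has no positive power of \<open>u\<close> makes it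
  possible to compute the coefficients of its products as Cauchy products.
\<close>

lemma two_uu_over_two_uu_minus_1_is_fps:
  assumes two: "(2::'k::field) \<noteq> 0"
  obtains a :: "'k::field fps" where "2 * uu / (2 * uu - 1) = fps_to_fls a"
proof
  let ?g = "1 - fps_const (1/2) * fps_X :: 'k fps"
  have g: "2 * uu * fps_to_fls ?g = 2 * uu - 1"
  proof -
    have "2 * uu * (fls_const (1/2) * fls_X) = fls_const 2 * fls_const (1/2) * (uu * (fls_X :: 'k fls))"
      by (simp add: fls_const_numeral)
    also have "uu * (fls_X :: 'k fls) = 1"
      by (rule fls_eqI) (simp add: fls_X_inv_times_conv_shift)
    also have "fls_const 2 * fls_const (1/2) * (1 :: 'k fls) = 1"
      using two by (simp add: fls_const_mult_const del: fls_const_numeral)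
    finally have "2 * uu * (fls_const (1/2) * fls_X) = (1 :: 'k fls)" .
    moreover have "fps_to_fls ?g = 1 - fls_const (1/2) * fls_X"
      by (simp add: fls_times_fps_to_fls)
    ultimately show ?thesis
      by (simp only: right_diff_distrib mult_1_right)
  qed
  have "?g * inverse ?g = 1"
    by (intro inverse_mult_eq_1') simp
  then have "fps_to_fls ?g * fps_to_fls (inverse ?g) = 1"
    by (simp only: fps_one_to_fls flip: fls_times_fps_to_fls)
  then have "2 * uu * (fps_to_fls ?g * fps_to_fls (inverse ?g)) = 2 * uu"
    by (simp only: mult_1_right)
  then have "2 * uu = fps_to_fls (inverse ?g) * (2 * uu * fps_to_fls ?g)"
    by (simp only: mult.left_commute mult.commute)
  then have "2 * uu = fps_to_fls (inverse ?g) * (2 * uu - 1)"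
    by (simp only: g)
  then show "2 * uu / (2 * uu - 1) = fps_to_fls (inverse ?g)"
    by (simp only: nonzero_divide_eq_eq [OF two_uu_minus_1_neq_0])
qed

text \<open>
  The coefficients on the left are the scalars by which those of \<open>\<beta>\<^sub>r(u)\<close> act when the bubble
  with \<open>j\<close> dots acts by \<open>b j\<close>.
\<close>

lemma series_of_beta_coefficients:
  fixes b :: "nat \<Rightarrow> 'k::field"
  assumes two: "(2::'k) \<noteq> 0"
  shows "fps_to_fls (Abs_fps (\<lambda>n. (if n = 0 then 1 else 0) +
      (\<Sum>j<n. fls_nth (2 * uu / (2 * uu - 1)) (int (n - 1 - j)) * b j)))
    = 1 + 2 * uu / (2 * uu - 1) * moment_series b 1"
proof -
  obtain a :: "'k fps" where a: "2 * uu / (2 * uu - 1) = fps_to_fls a"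
    using two_uu_over_two_uu_minus_1_is_fps [OF two] .
  have M: "moment_series b 1 = fps_to_fls (fps_X * Abs_fps b)"
    by (simp add: moment_series_def moment_functional_def fls_times_fps_to_fls)
  have "Abs_fps (\<lambda>n. (if n = 0 then 1 else 0) + (\<Sum>j<n. fps_nth a (n - 1 - j) * b j))
      = 1 + a * (fps_X * Abs_fps b)"
  proof (rule fps_ext)
    fix n
    have "fps_nth (1 + a * (fps_X * Abs_fps b)) n
      = (if n = 0 then 1 else 0) + fps_nth (fps_X * (Abs_fps b * a)) n"
      by (simp add: mult_ac)
    also have "fps_nth (fps_X * (Abs_fps b * a)) n = (\<Sum>j<n. b j * fps_nth a (n - 1 - j))"
      by (cases n) (simp_all add: fps_mult_nth [of "Abs_fps b"] lessThan_Suc_atMost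
          atLeast0AtMost)
    finally show "fps_nth (Abs_fps (\<lambda>n. (if n = 0 then 1 else 0)
        + (\<Sum>j<n. fps_nth a (n - 1 - j) * b j))) n = fps_nth (1 + a * (fps_X * Abs_fps b)) n"
      by (simp only: fps_nth_Abs_fps mult.commute)
  qed
  then show ?thesis
    unfolding a M by (simp add: fls_times_fps_to_fls del: of_nat_diff of_nat_Suc)
qed

section \<open>Linear maps and composition in linear categories\<close>

abbreviation scalars :: "'k::field ring" where "scalars \<equiv> ring_of_type_algebra"

lemma scalars_simps [simp]:
  "carrier (scalars :: 'k::field ring) = UNIV"
  "a \<oplus>\<^bsub>scalars\<^esub> b = (a + b :: 'k)" "a \<otimes>\<^bsub>scalars\<^esub> b = a * b"
  "\<one>\<^bsub>scalars\<^esub> = (1 :: 'k)" "\<zero>\<^bsub>scalars\<^esub> = (0 :: 'k)"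
  by (simp_all add: ring_of_type_algebra_def)

lemma uminus_scalars [simp]: "\<ominus>\<^bsub>scalars\<^esub> a = (- a :: 'k::field)"
proof -
  interpret cring "scalars :: 'k ring" by (rule cring_from_type_algebra)
  show ?thesis using minus_equality [of "- a" a] by simp
qed

lemma minus_one_smult:
  assumes "vector_space_over_k M" and "v \<in> carrier M"
  shows "(- 1) \<odot>\<^bsub>M\<^esub> v = \<ominus>\<^bsub>M\<^esub> v"
proof -
  interpret Module.module scalars M by fact
  show ?thesis using smult_l_minus [of 1 v] smult_one [of v] assms by simp
qed

lemma minus_one_smult_cancel:
  assumes "vector_space_over_k M" and "u \<in> carrier M" "v \<in> carrier M" "w \<in> carrier M"
    and "w \<oplus>\<^bsub>M\<^esub> (- 1) \<odot>\<^bsub>M\<^esub> u = w \<oplus>\<^bsub>M\<^esub> (- 1) \<odot>\<^bsub>M\<^esub> v"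
  shows "u = v"
proof -
  interpret Module.module scalars M by fact
  have "\<ominus>\<^bsub>M\<^esub> u = \<ominus>\<^bsub>M\<^esub> v"
    using assms by (simp add: minus_one_smult)
  then show ?thesis
    using assms by (metis M.minus_minus)
qed

lemma linear_mapD:
  assumes "linear_map V W f"
  shows "v \<in> carrier V \<Longrightarrow> f v \<in> carrier W"
    and "v \<in> carrier V \<Longrightarrow> w \<in> carrier V \<Longrightarrow> f (v \<oplus>\<^bsub>V\<^esub> w) = f v \<oplus>\<^bsub>W\<^esub> f w"
    and "v \<in> carrier V \<Longrightarrow> f (a \<odot>\<^bsub>V\<^esub> v) = a \<odot>\<^bsub>W\<^esub> f v"
  using assms by (auto simp: linear_map_def)

lemma linear_map_compose:
  assumes "linear_map U V f" and "linear_map V W g"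
  shows "linear_map U W (\<lambda>v. g (f v))"
  using assms by (auto simp: linear_map_def Pi_iff)

lemma linear_map_zero:
  assumes "vector_space_over_k V" "vector_space_over_k W" "linear_map V W f"
  shows "f \<zero>\<^bsub>V\<^esub> = \<zero>\<^bsub>W\<^esub>"
proof -
  interpret V: Module.module scalars V by fact
  interpret W: Module.module scalars W by fact
  have "f (0 \<odot>\<^bsub>V\<^esub> \<zero>\<^bsub>V\<^esub>) = 0 \<odot>\<^bsub>W\<^esub> f \<zero>\<^bsub>V\<^esub>"
    by (rule linear_mapD(3) [OF assms(3)]) simp
  then show ?thesis
    using V.smult_l_null [of "\<zero>\<^bsub>V\<^esub>"] W.smult_l_null [of "f \<zero>\<^bsub>V\<^esub>"]
      linear_mapD(1) [OF assms(3), of "\<zero>\<^bsub>V\<^esub>"] by simp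
qed

lemma linear_map_finsum:
  assumes "vector_space_over_k V" "vector_space_over_k W" "linear_map V W f"
    and "finite I" "g \<in> I \<rightarrow> carrier V"
  shows "f (finsum V g I) = finsum W (\<lambda>i. f (g i)) I"
  using assms(4,5)
proof (induction I)
  interpret V: Module.module scalars V by fact
  interpret W: Module.module scalars W by fact
  case empty
  show ?case using linear_map_zero [OF assms(1-3)] by simp
next
  interpret V: Module.module scalars V by fact
  interpret W: Module.module scalars W by fact
  case (insert i I)
  then have "finsum V g I \<in> carrier V" "g i \<in> carrier V" "g \<in> I \<rightarrow> carrier V"
    "(\<lambda>i. f (g i)) \<in> I \<rightarrow> carrier W" "f (g i) \<in> carrier W"
    by (auto intro!: V.finsum_closed linear_mapD(1) [OF assms(3)])
  with insert show ?case
    by (simp add: V.finsum_insert W.finsum_insert linear_mapD(2) [OF assms(3)])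
qed

text \<open>
  Since morphism spaces between different pairs of objects are disjoint, a morphism determines
  its source and target. With these functions the side conditions of associativity and
  functoriality involve only the morphisms themselves, so composites can be normalised by
  rewriting.
\<close>

definition source :: "('o, 'm, 'k, 'z) lincat_scheme \<Rightarrow> 'm \<Rightarrow> 'o"
  where "source C f = (THE X. X \<in> Ob C \<and> (\<exists>Y\<in>Ob C. f \<in> Arr C X Y))"

definition target :: "('o, 'm, 'k, 'z) lincat_scheme \<Rightarrow> 'm \<Rightarrow> 'o"
  where "target C f = (THE Y. Y \<in> Ob C \<and> (\<exists>X\<in>Ob C. f \<in> Arr C X Y))"

context linear_category
begin

abbreviation comp (infixr \<open>\<cdot>\<close> 75) where "g \<cdot> f \<equiv> cmp C g f"

lemma ArrD:
  assumes "f \<in> Arr C X Y" "X \<in> Ob C" "Y \<in> Ob C"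
  shows "f \<in> arrows C" "source C f = X" "target C f = Y"
proof -
  show "f \<in> arrows C" using assms by (auto simp: arrows_def)
  show "source C f = X"
    unfolding source_def using assms hom_disjoint by (intro the_equality) blast+
  show "target C f = Y"
    unfolding target_def using assms hom_disjoint by (intro the_equality) blast+
qed

lemma arrowsD:
  assumes "f \<in> arrows C"
  shows "f \<in> Arr C (source C f) (target C f)" "source C f \<in> Ob C" "target C f \<in> Ob C"
proof -
  obtain X Y where *: "f \<in> Arr C X Y" "X \<in> Ob C" "Y \<in> Ob C"
    using assms by (auto simp: arrows_def)
  show "f \<in> Arr C (source C f) (target C f)" "source C f \<in> Ob C" "target C f \<in> Ob C"
    using ArrD [OF *] * by simp_all
qed

lemma ArrI:
  "f \<in> arrows C \<Longrightarrow> source C f = X \<Longrightarrow> target C f = Y \<Longrightarrow> f \<in> Arr C X Y"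
  using arrowsD(1) by blast

lemma cmp_arrow [simp]:
  assumes "f \<in> arrows C" "g \<in> arrows C" "target C f = source C g"
  shows "g \<cdot> f \<in> arrows C" "source C (g \<cdot> f) = source C f" "target C (g \<cdot> f) = target C g"
proof -
  have "g \<cdot> f \<in> Arr C (source C f) (target C g)"
    by (rule cmp_in [of _ "source C g"])
       (use assms(3) arrowsD [OF assms(1)] arrowsD [OF assms(2)] in simp_all)
  from ArrD [OF this] show "g \<cdot> f \<in> arrows C" "source C (g \<cdot> f) = source C f"
    "target C (g \<cdot> f) = target C g"
    using assms by (simp_all add: arrowsD)
qed

lemma ident_arrow [simp]:
  assumes "X \<in> Ob C"
  shows "ident C X \<in> arrows C" "source C (ident C X) = X" "target C (ident C X) = X"
  using ArrD [OF ident_in] assms by simp_all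

lemma cmp_ident [simp]:
  "f \<in> arrows C \<Longrightarrow> target C f = X \<Longrightarrow> ident C X \<cdot> f = f"
  "f \<in> arrows C \<Longrightarrow> source C f = X \<Longrightarrow> f \<cdot> ident C X = f"
  using ident_left ident_right arrowsD by blast+

lemma cmp_assoc_arrows [simp]:
  assumes "f \<in> arrows C" "g \<in> arrows C" "h \<in> arrows C"
    "target C f = source C g" "target C g = source C h"
  shows "(h \<cdot> g) \<cdot> f = h \<cdot> g \<cdot> f"
  using cmp_assoc [of "source C f" "source C g" "source C h" "target C h" f g h] assms arrowsD
  by metis

text \<open>
  Composites are normalised by bracketing to the right, which hides a relation \<open>g f = g' f'\<close> as soon
  as something is composed on the right.
\<close>

lemma cmp_eq_in_context:
  assumes "g \<cdot> f = g' \<cdot> f'"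
    and "f \<in> arrows C" "g \<in> arrows C" "target C f = source C g"
    and "f' \<in> arrows C" "g' \<in> arrows C" "target C f' = source C g'"
    and "r \<in> arrows C" "target C r = source C f"
    and "target C r = source C f'"
  shows "g \<cdot> f \<cdot> r = g' \<cdot> f' \<cdot> r"
proof -
  have "g \<cdot> f \<cdot> r = (g \<cdot> f) \<cdot> r" using assms(2-4,8-10) by simp
  also have "\<dots> = g' \<cdot> f' \<cdot> r" unfolding assms(1) using assms(5-10) by simp
  finally show ?thesis .
qed

lemma cmp_right_linear:
  "g \<in> arrows C \<Longrightarrow> source C g = Y \<Longrightarrow> target C g = Z \<Longrightarrow> X \<in> Ob C \<Longrightarrow>
    linear_map (Hom C X Y) (Hom C X Z) (\<lambda>f. g \<cdot> f)"
  using cmp_linear_right [of X "source C g" "target C g" g] arrowsD by auto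

lemma cmp_left_linear:
  "f \<in> arrows C \<Longrightarrow> source C f = X \<Longrightarrow> target C f = Y \<Longrightarrow> Z \<in> Ob C \<Longrightarrow>
    linear_map (Hom C Y Z) (Hom C X Z) (\<lambda>g. g \<cdot> f)"
  using cmp_linear_left [of "source C f" "target C f" Z f] arrowsD by auto

end

section \<open>Polynomials in an endomorphism\<close>

context linear_category
begin

lemma cat_power_in [simp]:
  assumes "f \<in> Arr C X X" "X \<in> Ob C"
  shows "cat_power C X f n \<in> Arr C X X"
  by (induction n) (use assms in \<open>auto intro: ident_in cmp_in\<close>)

lemma cat_poly_in:
  assumes "f \<in> Arr C X X" "X \<in> Ob C"
  shows "cat_poly C X f p \<in> Arr C X X"
proof -
  interpret Module.module scalars "Hom C X X" by (rule hom_vector_space) fact+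
  show ?thesis
    unfolding cat_poly_def using assms by (intro finsum_closed Pi_I smult_closed) simp_all
qed

lemma cat_poly_0:
  assumes "f \<in> Arr C X X" "X \<in> Ob C"
  shows "cat_poly C X f 0 = zero_mor C X X"
proof -
  interpret Module.module scalars "Hom C X X" by (rule hom_vector_space) fact+
  show ?thesis
    using assms smult_l_null [of "ident C X"] by (simp add: cat_poly_def ident_in)
qed

lemma cat_poly_pCons:
  assumes f: "f \<in> Arr C X X" "X \<in> Ob C"
  shows "cat_poly C X f (pCons a p)
    = a \<odot>\<^bsub>Hom C X X\<^esub> ident C X \<oplus>\<^bsub>Hom C X X\<^esub> (f \<cdot> cat_poly C X f p)"
proof -
  interpret Module.module scalars "Hom C X X" by (rule hom_vector_space) fact+
  have [simp]: "f \<in> arrows C" "source C f = X" "target C f = X"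
    using ArrD [OF f(1)] f by simp_all
  have cmp_lin: "linear_map (Hom C X X) (Hom C X X) (\<lambda>g. f \<cdot> g)"
    using f by (intro cmp_right_linear) simp_all
  let ?t = "\<lambda>i. Polynomial.coeff p i \<odot>\<^bsub>Hom C X X\<^esub> cat_power C X f i"
  have t: "?t i \<in> Arr C X X" for i using f by (intro smult_closed) simp_all
  have f_t: "f \<cdot> ?t i = Polynomial.coeff p i \<odot>\<^bsub>Hom C X X\<^esub> (f \<cdot> cat_power C X f i)" for i
    using f by (intro linear_mapD(3) [OF cmp_lin]) simp_all
  have f_p: "f \<cdot> cat_poly C X f p = finsum (Hom C X X)
      (\<lambda>i. Polynomial.coeff p i \<odot>\<^bsub>Hom C X X\<^esub> cat_power C X f (Suc i)) {..Polynomial.degree p}"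
    unfolding cat_poly_def using f t
    by (subst linear_map_finsum [OF hom_vector_space hom_vector_space cmp_lin]) (auto simp: f_t)
  have s: "b \<odot>\<^bsub>Hom C X X\<^esub> (f \<cdot> cat_power C X f i) \<in> Arr C X X" for b i
    using linear_mapD(1) [OF cmp_lin cat_power_in [OF f, of i]] by simp
  have i: "b \<odot>\<^bsub>Hom C X X\<^esub> ident C X \<in> Arr C X X" for b
    using f by (simp add: ident_in)
  show ?thesis
  proof (cases "p = 0")
    case True
    have "f \<cdot> cat_poly C X f 0 = zero_mor C X X"
      using linear_map_zero [OF hom_vector_space hom_vector_space cmp_lin] f by (simp add: cat_poly_0)
    then show ?thesis
      using True i by (simp add: cat_poly_def)
  next
    case False
    then have "cat_poly C X f (pCons a p) = finsum (Hom C X X)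
      (\<lambda>i. Polynomial.coeff (pCons a p) i \<odot>\<^bsub>Hom C X X\<^esub> cat_power C X f i)
      {..Suc (Polynomial.degree p)}"
      by (simp add: cat_poly_def)
    also have "\<dots> = f \<cdot> cat_poly C X f p \<oplus>\<^bsub>Hom C X X\<^esub> a \<odot>\<^bsub>Hom C X X\<^esub> ident C X"
      unfolding f_p by (subst finsum_Suc2) (auto simp: f cat_power_in simp del: cat_power.simps, simp)
    also have "\<dots> = a \<odot>\<^bsub>Hom C X X\<^esub> ident C X \<oplus>\<^bsub>Hom C X X\<^esub> (f \<cdot> cat_poly C X f p)"
      using i linear_mapD(1) [OF cmp_lin cat_poly_in [OF f, of p]] by (intro M.a_comm)
    finally show ?thesis .
  qed
qed

lemma cat_poly_add:
  assumes f: "f \<in> Arr C X X" "X \<in> Ob C"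
  shows "cat_poly C X f (p + q) = cat_poly C X f p \<oplus>\<^bsub>Hom C X X\<^esub> cat_poly C X f q"
proof (induction p q rule: poly_induct2)
  interpret Module.module scalars "Hom C X X" by (rule hom_vector_space) fact+
  case 0
  show ?case using f by (simp add: cat_poly_0)
next
  interpret Module.module scalars "Hom C X X" by (rule hom_vector_space) fact+
  have cmp_lin: "linear_map (Hom C X X) (Hom C X X) (\<lambda>g. f \<cdot> g)"
    using f ArrD [OF f(1)] by (intro cmp_right_linear) simp_all
  case (pCons a p b q)
  have "a \<odot>\<^bsub>Hom C X X\<^esub> ident C X \<in> Arr C X X" for a using f by (simp add: ident_in)
  moreover have "f \<cdot> cat_poly C X f p \<in> Arr C X X" for p
    using linear_mapD(1) [OF cmp_lin] cat_poly_in [OF f] by blast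
  moreover have "(a + b) \<odot>\<^bsub>Hom C X X\<^esub> ident C X
      = a \<odot>\<^bsub>Hom C X X\<^esub> ident C X \<oplus>\<^bsub>Hom C X X\<^esub> b \<odot>\<^bsub>Hom C X X\<^esub> ident C X"
    using smult_l_distr [of a b "ident C X"] f by (simp add: ident_in)
  ultimately show ?case
    by (simp add: cat_poly_pCons f pCons linear_mapD(2) [OF cmp_lin] cat_poly_in M.a_ac)
qed

lemma cat_poly_smult:
  assumes f: "f \<in> Arr C X X" "X \<in> Ob C"
  shows "cat_poly C X f (Polynomial.smult a p) = a \<odot>\<^bsub>Hom C X X\<^esub> cat_poly C X f p"
proof (induction p)
  interpret Module.module scalars "Hom C X X" by (rule hom_vector_space) fact+
  case 0
  show ?case using f smult_r_null [of a] by (simp add: cat_poly_0)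
next
  interpret Module.module scalars "Hom C X X" by (rule hom_vector_space) fact+
  have cmp_lin: "linear_map (Hom C X X) (Hom C X X) (\<lambda>g. f \<cdot> g)"
    using f ArrD [OF f(1)] by (intro cmp_right_linear) simp_all
  case (pCons b p)
  have "b \<odot>\<^bsub>Hom C X X\<^esub> ident C X \<in> Arr C X X" for b using f by (simp add: ident_in)
  moreover have "f \<cdot> cat_poly C X f p \<in> Arr C X X"
    using linear_mapD(1) [OF cmp_lin] cat_poly_in [OF f] by blast
  moreover have "(a * b) \<odot>\<^bsub>Hom C X X\<^esub> ident C X
      = a \<odot>\<^bsub>Hom C X X\<^esub> (b \<odot>\<^bsub>Hom C X X\<^esub> ident C X)"
    using smult_assoc1 [of a b "ident C X"] f by (simp add: ident_in)
  ultimately show ?case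
    using smult_r_distr [of a "b \<odot>\<^bsub>Hom C X X\<^esub> ident C X" "f \<cdot> cat_poly C X f p"]
    by (simp add: cat_poly_pCons f pCons linear_mapD(3) [OF cmp_lin] cat_poly_in)
qed

lemma cat_poly_commute:
  assumes f: "f \<in> Arr C X X" "X \<in> Ob C"
  shows "cat_poly C X f p \<cdot> f = f \<cdot> cat_poly C X f p"
proof (induction p)
  case 0
  have cmp_lin: "linear_map (Hom C X X) (Hom C X X) (\<lambda>g. g \<cdot> f)"
    "linear_map (Hom C X X) (Hom C X X) (\<lambda>g. f \<cdot> g)"
    using f ArrD [OF f(1)] by (auto intro!: cmp_left_linear cmp_right_linear)
  show ?case
    using linear_map_zero [OF hom_vector_space hom_vector_space cmp_lin(1)]
      linear_map_zero [OF hom_vector_space hom_vector_space cmp_lin(2)] f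
    by (simp only: cat_poly_0)
next
  case (pCons a p)
  have cmp_lin: "linear_map (Hom C X X) (Hom C X X) (\<lambda>g. g \<cdot> f)"
    "linear_map (Hom C X X) (Hom C X X) (\<lambda>g. f \<cdot> g)"
    using f ArrD [OF f(1)] by (auto intro!: cmp_left_linear cmp_right_linear)
  interpret Module.module scalars "Hom C X X" by (rule hom_vector_space) fact+
  have [simp]: "f \<in> arrows C" "source C f = X" "target C f = X"
    "cat_poly C X f p \<in> arrows C" "source C (cat_poly C X f p) = X"
    "target C (cat_poly C X f p) = X"
    using ArrD [OF f(1)] ArrD [OF cat_poly_in [OF f]] f by simp_all
  have "a \<odot>\<^bsub>Hom C X X\<^esub> ident C X \<in> Arr C X X" using f by (simp add: ident_in)
  moreover have "f \<cdot> cat_poly C X f p \<in> Arr C X X"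
    using f by (intro ArrI) simp_all
  ultimately show ?case
    using f by (simp add: cat_poly_pCons linear_mapD(2,3) [OF cmp_lin(1)] linear_mapD(2,3) [OF cmp_lin(2)]
      ident_in pCons)
qed

text \<open>
  A linear map is determined on polynomials in \<open>f\<close> by its values on the powers of \<open>f\<close>. The
  induction replaces \<open>T\<close> by \<open>g \<mapsto> T (f g)\<close>, which shifts the sequence \<open>b\<close> by one.
\<close>

lemma linear_map_cat_poly:
  assumes f: "f \<in> Arr C X X" "X \<in> Ob C"
    and T: "linear_map (Hom C X X) W T" and W: "vector_space_over_k W" and w: "w \<in> carrier W"
    and b: "\<And>n. T (cat_power C X f n) = b n \<odot>\<^bsub>W\<^esub> w"
  shows "T (cat_poly C X f p) = moment_functional b p \<odot>\<^bsub>W\<^esub> w"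
  using T b
proof (induction p arbitrary: T b)
  case 0
  interpret W: Module.module scalars W by (rule W)
  show ?case
    using f W.smult_l_null [OF w] linear_map_zero [OF hom_vector_space W 0(1)]
    by (simp add: cat_poly_0)
next
  case (pCons a p)
  interpret W: Module.module scalars W by (rule W)
  interpret X: Module.module scalars "Hom C X X" by (rule hom_vector_space) fact+
  have cmp_lin: "linear_map (Hom C X X) (Hom C X X) (\<lambda>g. f \<cdot> g)"
    using f ArrD [OF f(1)] by (intro cmp_right_linear) simp_all
  have "T (f \<cdot> cat_poly C X f p) = moment_functional (\<lambda>i. b (Suc i)) p \<odot>\<^bsub>W\<^esub> w"
    by (rule pCons.IH [OF linear_map_compose [OF cmp_lin pCons.prems(1)]])
       (simp add: flip: pCons.prems(2))
  moreover have "T (ident C X) = b 0 \<odot>\<^bsub>W\<^esub> w"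
    using pCons.prems(2) [of 0] by simp
  moreover have "a \<odot>\<^bsub>Hom C X X\<^esub> ident C X \<in> Arr C X X" using f by (simp add: ident_in)
  moreover have "f \<cdot> cat_poly C X f p \<in> Arr C X X"
    using linear_mapD(1) [OF cmp_lin] cat_poly_in [OF f] by blast
  ultimately show ?case
    using f w W.smult_l_distr [of "a * b 0" "moment_functional (\<lambda>i. b (Suc i)) p" w]
      W.smult_assoc1 [of a "b 0" w]
    by (simp add: cat_poly_pCons linear_mapD(2,3) [OF pCons.prems(1)] ident_in moment_functional_pCons)
qed

end

lemma linear_functor_cat_power:
  assumes "linear_category C" "linear_functor C D G" "f \<in> Arr C X X" "X \<in> Ob C"
  shows "fmor G (cat_power C X f n) = cat_power D (fob G X) (fmor G f) n"
proof (induction n)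
  case 0
  show ?case using assms by (simp add: linear_functor.fmor_ident)
next
  case (Suc n)
  then show ?case
    using linear_functor.fmor_cmp [OF assms(2,4,4,4)
        linear_category.cat_power_in [OF assms(1,3,4), of n] assms(3)] by simp
qed

lemma linear_functor_cat_poly:
  assumes "linear_category C" "linear_category D" "linear_functor C D G"
    and "f \<in> Arr C X X" "X \<in> Ob C"
  shows "fmor G (cat_poly C X f p) = cat_poly D (fob G X) (fmor G f) p"
proof -
  interpret C: linear_category C by fact
  interpret D: linear_category D by fact
  interpret G: linear_functor C D G by fact
  interpret H: Module.module scalars "Hom C X X" by (rule C.hom_vector_space) fact+
  have "fmor G (cat_poly C X f p) = finsum (Hom D (fob G X) (fob G X))
      (\<lambda>i. fmor G (Polynomial.coeff p i \<odot>\<^bsub>Hom C X X\<^esub> cat_power C X f i)) {..Polynomial.degree p}"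
    unfolding cat_poly_def using assms(4,5)
    by (intro linear_map_finsum C.hom_vector_space D.hom_vector_space G.fmor_linear G.fob_in
        Pi_I H.smult_closed C.cat_power_in) simp_all
  then show ?thesis
    using linear_mapD(3) [OF G.fmor_linear [OF assms(5,5)] C.cat_power_in [OF assms(4,5)]]
    by (simp add: cat_poly_def linear_functor_cat_power [OF assms(1,3,4,5)])
qed

section \<open>Curls and bubbles for an endofunctor\<close>

locale linear_endofunctor = linear_category C + linear_functor C C F
  for C :: "('o, 'm, 'k::field) lincat" and F :: "('o, 'm) endofun"
begin

abbreviation FO where "FO \<equiv> fob F"
abbreviation FM where "FM \<equiv> fmor F"

declare fob_in [simp]

lemma FM_in: "f \<in> Arr C X Y \<Longrightarrow> X \<in> Ob C \<Longrightarrow> Y \<in> Ob C \<Longrightarrow> FM f \<in> Arr C (FO X) (FO Y)"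
  using linear_mapD(1) [OF fmor_linear] by blast

lemma FM_arrow [simp]:
  assumes "f \<in> arrows C"
  shows "FM f \<in> arrows C" "source C (FM f) = FO (source C f)" "target C (FM f) = FO (target C f)"
  using ArrD [OF FM_in [OF arrowsD [OF assms]]] arrowsD [OF assms] by simp_all

lemma FM_cmp [simp]:
  assumes "f \<in> arrows C" "g \<in> arrows C" "target C f = source C g"
  shows "FM (g \<cdot> f) = FM g \<cdot> FM f"
  using fmor_cmp [of "source C f" "source C g" "target C g" f g] assms arrowsD by metis

lemma FM_ident [simp]: "X \<in> Ob C \<Longrightarrow> FM (ident C X) = ident C (FO X)"
  by (rule fmor_ident)

end

text \<open>
  The data that a module category over the affine Brauer category gives on its underlying
  category. Because tensoring with the identity of \<open>B\<close> on the left is application of \<open>F\<close> and on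
  the right is evaluation at \<open>F X\<close>, the strict monoidal structure disappears and each relation
  becomes an equation between morphisms of \<open>C\<close>.
\<close>

locale brauer_endofunctor = linear_endofunctor C F
  for C :: "('o, 'm, 'k::field) lincat" and F :: "('o, 'm) endofun" +
  fixes cap cup s x :: "'o \<Rightarrow> 'm"
  assumes cap_in: "X \<in> Ob C \<Longrightarrow> cap X \<in> Arr C (FO (FO X)) X"
    and cup_in: "X \<in> Ob C \<Longrightarrow> cup X \<in> Arr C X (FO (FO X))"
    and s_in: "X \<in> Ob C \<Longrightarrow> s X \<in> Arr C (FO (FO X)) (FO (FO X))"
    and x_in: "X \<in> Ob C \<Longrightarrow> x X \<in> Arr C (FO X) (FO X)"
    and cap_natural: "f \<in> arrows C \<Longrightarrow> cap (target C f) \<cdot> FM (FM f) = f \<cdot> cap (source C f)"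
    and cup_natural: "f \<in> arrows C \<Longrightarrow> cup (target C f) \<cdot> f = FM (FM f) \<cdot> cup (source C f)"
    and s_natural: "f \<in> arrows C \<Longrightarrow> s (target C f) \<cdot> FM (FM f) = FM (FM f) \<cdot> s (source C f)"
    and x_natural: "f \<in> arrows C \<Longrightarrow> x (target C f) \<cdot> FM f = FM f \<cdot> x (source C f)"
    and zigzag_left: "X \<in> Ob C \<Longrightarrow> FM (cap X) \<cdot> cup (FO X) = ident C (FO X)"
    and zigzag_right: "X \<in> Ob C \<Longrightarrow> cap (FO X) \<cdot> FM (cup X) = ident C (FO X)"
    and cap_s: "X \<in> Ob C \<Longrightarrow> cap X \<cdot> s X = cap X"
    and cap_slide: "X \<in> Ob C \<Longrightarrow> FM (cap X) \<cdot> s (FO X) = cap (FO X) \<cdot> FM (s X)"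
    and dot_s: "X \<in> Ob C \<Longrightarrow>
      x (FO X) \<cdot> s X \<oplus>\<^bsub>Hom C (FO (FO X)) (FO (FO X))\<^esub>
        (- 1) \<odot>\<^bsub>Hom C (FO (FO X)) (FO (FO X))\<^esub> (s X \<cdot> FM (x X))
      = ident C (FO (FO X)) \<oplus>\<^bsub>Hom C (FO (FO X)) (FO (FO X))\<^esub>
        (- 1) \<odot>\<^bsub>Hom C (FO (FO X)) (FO (FO X))\<^esub> (cup X \<cdot> cap X)"
    and cap_dot: "X \<in> Ob C \<Longrightarrow>
      cap X \<cdot> x (FO X) = (- 1) \<odot>\<^bsub>Hom C (FO (FO X)) X\<^esub> (cap X \<cdot> FM (x X))"
begin

lemma generator_arrows [simp]:
  assumes "X \<in> Ob C"
  shows "cap X \<in> arrows C" "source C (cap X) = FO (FO X)" "target C (cap X) = X"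
    and "cup X \<in> arrows C" "source C (cup X) = X" "target C (cup X) = FO (FO X)"
    and "s X \<in> arrows C" "source C (s X) = FO (FO X)" "target C (s X) = FO (FO X)"
    and "x X \<in> arrows C" "source C (x X) = FO X" "target C (x X) = FO X"
  using ArrD [OF cap_in] ArrD [OF cup_in] ArrD [OF s_in] ArrD [OF x_in] assms by simp_all

text \<open>
  The crossing is invariant under a quarter turn: slide the crossing to the other side of the
  cap, then undo the zigzag.
\<close>

lemma s_rotate:
  assumes [simp]: "X \<in> Ob C"
  shows "s X = cap (FO (FO X)) \<cdot> FM (s (FO X)) \<cdot> FM (FM (cup X))"
proof -
  have "cap (FO (FO X)) \<cdot> FM (s (FO X)) \<cdot> FM (FM (cup X))
      = FM (cap (FO X)) \<cdot> s (FO (FO X)) \<cdot> FM (FM (cup X))"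
    using cap_slide [of "FO X"] by (intro cmp_eq_in_context) simp_all
  also have "\<dots> = FM (cap (FO X)) \<cdot> FM (FM (cup X)) \<cdot> s X"
    using s_natural [of "cup X"] by simp
  also have "\<dots> = FM (cap (FO X) \<cdot> FM (cup X)) \<cdot> s X" by simp
  also have "\<dots> = s X" unfolding zigzag_right [OF assms] by simp
  finally show ?thesis by simp
qed

abbreviation undotted_curl where
  "undotted_curl X \<equiv> cap (FO X) \<cdot> FM (s X) \<cdot> FM (cup X)"

text \<open>
  Inserting the rotated crossing into \<open>cap s = cap\<close> shows that a curl \<open>T\<close> on one leg of a cap can be
  removed, \<open>cap \<cdot> F T = cap\<close>. Bending that leg by the zigzag relation gives \<open>T = 1\<close>.
\<close>

lemma undotted_curl_eq_ident:
  assumes [simp]: "X \<in> Ob C"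
  shows "undotted_curl X = ident C (FO X)"
proof -
  let ?T = "undotted_curl X"
  have slide: "cap (FO X) \<cdot> FM (s X) \<cdot> FM (cup X) = FM (cap X) \<cdot> s (FO X) \<cdot> FM (cup X)"
    using cap_slide [of X] by (intro cmp_eq_in_context) simp_all
  have "cap X \<cdot> s X = cap X \<cdot> cap (FO (FO X)) \<cdot> FM (s (FO X)) \<cdot> FM (FM (cup X))"
    by (subst s_rotate) simp_all
  also have "\<dots> = cap X \<cdot> FM (FM (cap X)) \<cdot> FM (s (FO X)) \<cdot> FM (FM (cup X))"
    using cap_natural [of "cap X"] by (intro cmp_eq_in_context) simp_all
  also have "\<dots> = cap X \<cdot> FM ?T"
    unfolding slide by simp
  finally have cap_T: "cap X \<cdot> FM ?T = cap X"
    by (simp only: cap_s [OF assms])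
  \<comment> \<open>Naturality of the cup moves \<open>?T\<close> through the zigzag onto the leg of the cap.\<close>
  have "?T = (FM (cap X) \<cdot> cup (FO X)) \<cdot> ?T"
    unfolding zigzag_left [OF assms] by simp
  also have "\<dots> = FM (cap X) \<cdot> cup (FO X) \<cdot> ?T"
    by simp
  also have "cup (FO X) \<cdot> ?T = FM (FM ?T) \<cdot> cup (FO X)"
    using cup_natural [of ?T] by simp
  also have "FM (cap X) \<cdot> \<dots> = FM (cap X \<cdot> FM ?T) \<cdot> cup (FO X)"
    by simp
  also have "\<dots> = ident C (FO X)"
    by (simp only: cap_T zigzag_left [OF assms])
  finally show ?thesis .
qed

text \<open>
  The curl whose loop carries \<open>h\<close>. The decorated strand is the rightmost one, next to \<open>X\<close>, so
  it can carry any endomorphism of \<open>F X\<close>, not only a polynomial in the dot.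
\<close>

definition curl :: "'o \<Rightarrow> 'm \<Rightarrow> 'm"
  where "curl X h = cap (FO X) \<cdot> FM (s X) \<cdot> FM (FM h) \<cdot> FM (cup X)"

text \<open>The bubble whose right half, the one next to \<open>X\<close>, carries \<open>h\<close>.\<close>

definition closure :: "'o \<Rightarrow> 'm \<Rightarrow> 'm"
  where "closure X h = cap X \<cdot> FM h \<cdot> cup X"

lemma curl_linear:
  assumes [simp]: "X \<in> Ob C"
  shows "linear_map (Hom C (FO X) (FO X)) (Hom C (FO X) (FO X)) (curl X)"
proof -
  have "linear_map (Hom C (FO X) (FO X)) (Hom C (FO (FO (FO X))) (FO (FO (FO X)))) (\<lambda>h. FM (FM h))"
    by (intro linear_map_compose [OF fmor_linear fmor_linear]) simp_all
  from linear_map_compose [OF this cmp_left_linear [of "FM (cup X)" "FO X"]]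
  have "linear_map (Hom C (FO X) (FO X)) (Hom C (FO X) (FO (FO (FO X))))
      (\<lambda>h. FM (FM h) \<cdot> FM (cup X))"
    by simp
  from linear_map_compose [OF this cmp_right_linear [of "FM (s X)" _ "FO (FO (FO X))"]]
  have "linear_map (Hom C (FO X) (FO X)) (Hom C (FO X) (FO (FO (FO X))))
      (\<lambda>h. FM (s X) \<cdot> FM (FM h) \<cdot> FM (cup X))"
    by simp
  from linear_map_compose [OF this cmp_right_linear [of "cap (FO X)" _ "FO X"]]
  show ?thesis by (simp add: curl_def [abs_def])
qed

lemma closure_linear:
  assumes [simp]: "X \<in> Ob C"
  shows "linear_map (Hom C (FO X) (FO X)) (Hom C X X) (closure X)"
proof -
  from linear_map_compose [OF fmor_linear [of "FO X" "FO X"] cmp_left_linear [of "cup X" X]]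
  have "linear_map (Hom C (FO X) (FO X)) (Hom C X (FO (FO X))) (\<lambda>h. FM h \<cdot> cup X)"
    by simp
  from linear_map_compose [OF this cmp_right_linear [of "cap X" _ X]]
  show ?thesis by (simp add: closure_def [abs_def])
qed

lemma curl_ident:
  "X \<in> Ob C \<Longrightarrow> curl X (ident C (FO X)) = ident C (FO X)"
  using undotted_curl_eq_ident [of X] by (simp add: curl_def)

text \<open>
  The curl relation, obtained by inserting both sides of \<open>dot_s\<close> for the crossing of a
  curl with loop \<open>h\<close>. A dot above the crossing moves over the cap, changing its sign, and then
  down the through strand. Without the crossing the strand straightens to \<open>h\<close>, and with \<open>cup \<cdot> cap\<close>
  in place of the crossing the loop splits off as a bubble.
\<close>

lemma curl_dot:
  assumes [simp]: "X \<in> Ob C" and h: "h \<in> Arr C (FO X) (FO X)"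
  shows "(- 1) \<odot>\<^bsub>Hom C (FO X) (FO X)\<^esub> (curl X h \<cdot> x X)
      \<oplus>\<^bsub>Hom C (FO X) (FO X)\<^esub> (- 1) \<odot>\<^bsub>Hom C (FO X) (FO X)\<^esub> curl X (x X \<cdot> h)
    = h \<oplus>\<^bsub>Hom C (FO X) (FO X)\<^esub> (- 1) \<odot>\<^bsub>Hom C (FO X) (FO X)\<^esub> FM (closure X h)"
proof -
  have [simp]: "h \<in> arrows C" "source C h = FO X" "target C h = FO X"
    using ArrD [OF h] by simp_all
  let ?E = "Hom C (FO (FO X)) (FO (FO X))" and ?H = "Hom C (FO X) (FO X)"
  \<comment> \<open>\<open>T g\<close> is the curl with loop \<open>h\<close> in which \<open>g\<close> replaces the crossing.\<close>
  define T where "T = (\<lambda>g. cap (FO X) \<cdot> FM (g \<cdot> FM h \<cdot> cup X))"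
  have T: "linear_map ?E ?H T"
  proof -
    from linear_map_compose [OF cmp_left_linear [of "FM h \<cdot> cup X" X "FO (FO X)" "FO (FO X)"]
        fmor_linear [of X "FO (FO X)"]]
    have "linear_map ?E (Hom C (FO X) (FO (FO (FO X)))) (\<lambda>g. FM (g \<cdot> FM h \<cdot> cup X))"
      by simp
    from linear_map_compose [OF this cmp_right_linear [of "cap (FO X)" _ "FO X"]]
    show ?thesis by (simp add: T_def)
  qed
  have T1: "T (x (FO X) \<cdot> s X) = (- 1) \<odot>\<^bsub>?H\<^esub> (curl X h \<cdot> x X)"
  proof -
    let ?g = "s X \<cdot> FM h \<cdot> cup X"
    have "T (x (FO X) \<cdot> s X) = cap (FO X) \<cdot> FM (x (FO X)) \<cdot> FM ?g"
      by (simp add: T_def)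
    also have "\<dots> = (- 1) \<odot>\<^bsub>?H\<^esub> (cap (FO X) \<cdot> x (FO (FO X)) \<cdot> FM ?g)"
    proof -
      have m: "(- 1) \<odot>\<^bsub>Hom C (FO (FO (FO X))) (FO X)\<^esub> ((- 1) \<odot>\<^bsub>Hom C (FO (FO (FO X))) (FO X)\<^esub> v) = v"
        if "v \<in> Arr C (FO (FO (FO X))) (FO X)" for v
      proof -
        interpret Module.module scalars "Hom C (FO (FO (FO X))) (FO X)"
          by (intro hom_vector_space) simp_all
        show ?thesis
          using smult_assoc1 [of "-1" "-1" v] smult_one [of v] that by simp
      qed
      have "cap (FO X) \<cdot> FM (x (FO X))
          = (- 1) \<odot>\<^bsub>Hom C (FO (FO (FO X))) (FO X)\<^esub> (cap (FO X) \<cdot> x (FO (FO X)))"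
        by (subst cap_dot) (simp_all add: m ArrI)
      moreover have "cap (FO X) \<cdot> FM (x (FO X)) \<cdot> FM ?g = (cap (FO X) \<cdot> FM (x (FO X))) \<cdot> FM ?g"
        by simp
      ultimately have "cap (FO X) \<cdot> FM (x (FO X)) \<cdot> FM ?g
          = ((- 1) \<odot>\<^bsub>Hom C (FO (FO (FO X))) (FO X)\<^esub> (cap (FO X) \<cdot> x (FO (FO X)))) \<cdot> FM ?g"
        by (simp only:)
      also have "\<dots> = (- 1) \<odot>\<^bsub>?H\<^esub> ((cap (FO X) \<cdot> x (FO (FO X))) \<cdot> FM ?g)"
        by (rule linear_mapD(3) [OF cmp_left_linear]) (simp_all add: ArrI)
      finally show ?thesis by simp
    qed
    also have "x (FO (FO X)) \<cdot> FM ?g = FM ?g \<cdot> x X"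
      using x_natural [of ?g] by simp
    finally show ?thesis by (simp add: curl_def)
  qed
  have T2: "T (s X \<cdot> FM (x X)) = curl X (x X \<cdot> h)"
    by (simp add: T_def curl_def)
  have T3: "T (ident C (FO (FO X))) = h"
  proof -
    have "T (ident C (FO (FO X))) = cap (FO X) \<cdot> FM (FM h) \<cdot> FM (cup X)"
      by (simp add: T_def)
    also have "\<dots> = h \<cdot> cap (FO X) \<cdot> FM (cup X)"
      using cap_natural [of h] by (intro cmp_eq_in_context) simp_all
    also have "\<dots> = h" by (simp add: zigzag_right)
    finally show ?thesis .
  qed
  have T4: "T (cup X \<cdot> cap X) = FM (closure X h)"
  proof -
    have "T (cup X \<cdot> cap X) = (cap (FO X) \<cdot> FM (cup X)) \<cdot> FM (closure X h)"
      by (simp add: T_def closure_def)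
    also have "\<dots> = FM (closure X h)"
      unfolding zigzag_right [OF assms(1)] by (simp add: closure_def)
    finally show ?thesis .
  qed
  have E: "x (FO X) \<cdot> s X \<in> carrier ?E" "s X \<cdot> FM (x X) \<in> carrier ?E"
    "ident C (FO (FO X)) \<in> carrier ?E" "cup X \<cdot> cap X \<in> carrier ?E"
    by (simp_all add: ArrI)
  interpret E: Module.module scalars ?E by (intro hom_vector_space) simp_all
  have "T (x (FO X) \<cdot> s X \<oplus>\<^bsub>?E\<^esub> (- 1) \<odot>\<^bsub>?E\<^esub> (s X \<cdot> FM (x X)))
      = T (ident C (FO (FO X)) \<oplus>\<^bsub>?E\<^esub> (- 1) \<odot>\<^bsub>?E\<^esub> (cup X \<cdot> cap X))"
    by (simp only: dot_s [OF assms(1)])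
  then show ?thesis
    using E by (simp add: linear_mapD(2,3) [OF T] T1 T2 T3 T4)
qed

text \<open>
  Once the bubbles with dots are scalars, the curl relation has the form of the recursion for
  \<^const>\<open>curl_poly\<close>.
\<close>

lemma curl_cat_poly:
  assumes X [simp]: "X \<in> Ob C"
    and b: "\<And>n. closure X (cat_power C (FO X) (x X) n) = b n \<odot>\<^bsub>Hom C X X\<^esub> ident C X"
  shows "curl X (cat_poly C (FO X) (x X) p) = cat_poly C (FO X) (x X) (curl_poly b p)"
proof (induction p)
  case 0
  show ?case
    using linear_map_zero [OF hom_vector_space hom_vector_space curl_linear]
    by (simp add: cat_poly_0 x_in)
next
  case (pCons a p)
  let ?H = "Hom C (FO X) (FO X)" and ?ev = "cat_poly C (FO X) (x X)"
  interpret Module.module scalars ?H by (intro hom_vector_space) simp_all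
  have ev_in: "?ev q \<in> carrier ?H" for q by (simp add: cat_poly_in x_in)
  have [simp]: "?ev q \<in> arrows C" "source C (?ev q) = FO X" "target C (?ev q) = FO X" for q
    using ArrD [OF ev_in [of q]] by simp_all
  have x_ev: "x X \<cdot> ?ev q \<in> carrier ?H" for q by (simp add: ArrI)
  have ident: "ident C (FO X) \<in> carrier ?H" by (simp add: ident_in)
  have ev_const: "?ev [:c:] = c \<odot>\<^bsub>?H\<^esub> ident C (FO X)" for c
  proof -
    have "linear_map ?H ?H (\<lambda>g. x X \<cdot> g)" by (intro cmp_right_linear) simp_all
    then have "x X \<cdot> ?ev 0 = \<zero>\<^bsub>?H\<^esub>"
      using linear_map_zero [OF hom_vector_space hom_vector_space] by (simp add: cat_poly_0 x_in)
    then show ?thesis using ident by (simp add: cat_poly_pCons x_in)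
  qed
  have ev_pCons_0: "?ev (pCons 0 q) = x X \<cdot> ?ev q" for q
    using x_ev smult_l_null [OF ident] by (simp add: cat_poly_pCons x_in)
  have F: "FM (closure X (?ev p)) = ?ev [:moment_functional b p:]"
  proof -
    have "closure X (?ev p) = moment_functional b p \<odot>\<^bsub>Hom C X X\<^esub> ident C X"
      by (rule linear_map_cat_poly [OF x_in _ closure_linear hom_vector_space])
         (simp_all add: b ident_in)
    then show ?thesis
      by (simp add: linear_mapD(3) [OF fmor_linear] ident_in ev_const)
  qed
  \<comment> \<open>The dotted curl is determined by the curl relation, because its sum with a known
    morphism is known; \<open>?q\<close> solves the same equation among polynomials.\<close>
  let ?q = "[:moment_functional b p:] - pCons 0 (curl_poly b p) - p"
  have "curl X (x X \<cdot> ?ev p) = ?ev ?q"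
  proof (rule minus_one_smult_cancel)
    show "vector_space_over_k ?H" by (intro hom_vector_space) simp_all
    show "curl X (x X \<cdot> ?ev p) \<in> carrier ?H"
      using x_ev by (rule linear_mapD(1) [OF curl_linear [OF X]])
    show "?ev ?q \<in> carrier ?H" by (rule ev_in)
    show "(- 1) \<odot>\<^bsub>?H\<^esub> (curl X (?ev p) \<cdot> x X) \<in> carrier ?H"
      by (intro smult_closed) (simp_all add: pCons.IH ArrI)
    have "(- 1) \<odot>\<^bsub>?H\<^esub> (curl X (?ev p) \<cdot> x X) \<oplus>\<^bsub>?H\<^esub> (- 1) \<odot>\<^bsub>?H\<^esub> curl X (x X \<cdot> ?ev p)
        = ?ev p \<oplus>\<^bsub>?H\<^esub> (- 1) \<odot>\<^bsub>?H\<^esub> ?ev [:moment_functional b p:]"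
      unfolding F [symmetric] by (intro curl_dot ev_in X)
    also have "\<dots> = ?ev (p + Polynomial.smult (- 1) [:moment_functional b p:])"
      by (simp only: x_in X fob_in cat_poly_add cat_poly_smult)
    also have "p + Polynomial.smult (- 1) [:moment_functional b p:]
        = Polynomial.smult (- 1) (pCons 0 (curl_poly b p)) + Polynomial.smult (- 1) ?q"
      by (simp add: poly_eq_iff coeff_pCons split: nat.split)
    also have "?ev \<dots> = (- 1) \<odot>\<^bsub>?H\<^esub> (x X \<cdot> ?ev (curl_poly b p)) \<oplus>\<^bsub>?H\<^esub> (- 1) \<odot>\<^bsub>?H\<^esub> ?ev ?q"
      by (simp only: x_in X fob_in cat_poly_add cat_poly_smult ev_pCons_0)
    also have "x X \<cdot> ?ev (curl_poly b p) = curl X (?ev p) \<cdot> x X"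
      by (simp add: pCons.IH cat_poly_commute x_in)
    finally show "(- 1) \<odot>\<^bsub>?H\<^esub> (curl X (?ev p) \<cdot> x X) \<oplus>\<^bsub>?H\<^esub> (- 1) \<odot>\<^bsub>?H\<^esub> curl X (x X \<cdot> ?ev p)
        = (- 1) \<odot>\<^bsub>?H\<^esub> (curl X (?ev p) \<cdot> x X) \<oplus>\<^bsub>?H\<^esub> (- 1) \<odot>\<^bsub>?H\<^esub> ?ev ?q" .
  qed
  then have "curl X (?ev (pCons a p)) = ?ev [:a:] \<oplus>\<^bsub>?H\<^esub> ?ev ?q"
    using x_ev ident
    by (simp add: cat_poly_pCons x_in linear_mapD(2,3) [OF curl_linear] curl_ident ev_const)
  also have "\<dots> = ?ev (curl_poly b (pCons a p))"
  proof -
    have "curl_poly b (pCons a p) = [:a:] + ?q"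
      by (simp add: curl_poly_pCons poly_eq_iff coeff_pCons split: nat.split)
    then show ?thesis by (simp only: cat_poly_add x_in X fob_in)
  qed
  finally show ?case .
qed

end

section \<open>The affine Brauer category as a linear category\<close>

text \<open>
  The typing judgement of terms, split into functions so that it can be decided by rewriting.
\<close>

primrec ab_dom :: "'k ab_term \<Rightarrow> nat" where
  "ab_dom (Idt n) = n" | "ab_dom Cap = 2" | "ab_dom Cup = 0" | "ab_dom Swap = 2" | "ab_dom Dot = 1"
| "ab_dom (Cmp s t) = ab_dom t" | "ab_dom (Tens s t) = ab_dom s + ab_dom t" | "ab_dom (Zero m n) = m"
| "ab_dom (Plus s t) = ab_dom s" | "ab_dom (Scale a t) = ab_dom t"

primrec ab_cod :: "'k ab_term \<Rightarrow> nat" where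
  "ab_cod (Idt n) = n" | "ab_cod Cap = 0" | "ab_cod Cup = 2" | "ab_cod Swap = 2" | "ab_cod Dot = 1"
| "ab_cod (Cmp s t) = ab_cod s" | "ab_cod (Tens s t) = ab_cod s + ab_cod t" | "ab_cod (Zero m n) = n"
| "ab_cod (Plus s t) = ab_cod s" | "ab_cod (Scale a t) = ab_cod t"

primrec ab_wt :: "'k ab_term \<Rightarrow> bool" where
  "ab_wt (Idt n) = True" | "ab_wt Cap = True" | "ab_wt Cup = True" | "ab_wt Swap = True" | "ab_wt Dot = True"
| "ab_wt (Cmp s t) = (ab_wt s \<and> ab_wt t \<and> ab_cod t = ab_dom s)" | "ab_wt (Tens s t) = (ab_wt s \<and> ab_wt t)"
| "ab_wt (Zero m n) = True"
| "ab_wt (Plus s t) = (ab_wt s \<and> ab_wt t \<and> ab_dom s = ab_dom t \<and> ab_cod s = ab_cod t)" | "ab_wt (Scale a t) = ab_wt t"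

lemma ab_wt_imp_ab_typed: "ab_wt t \<Longrightarrow> ab_typed t (ab_dom t) (ab_cod t)"
proof (induction t)
  case (Cmp s t)
  then show ?case by (auto intro: ab_typed.intros(6))
next
  case (Plus s t)
  then show ?case by (auto intro: ab_typed.intros(9))
qed (auto intro: ab_typed.intros(1-4,7,8,10) ab_typed.intros(5) [unfolded One_nat_def])

lemma ab_typed_iff: "ab_typed t m n \<longleftrightarrow> ab_wt t \<and> ab_dom t = m \<and> ab_cod t = n"
proof
  show "ab_typed t m n \<Longrightarrow> ab_wt t \<and> ab_dom t = m \<and> ab_cod t = n"
    by (induction rule: ab_typed.induct) auto
qed (use ab_wt_imp_ab_typed in blast)

lemma ab_eq_preserves_type:
  "ab_eq t s \<Longrightarrow> ab_wt t \<and> ab_wt s \<and> ab_dom t = ab_dom s \<and> ab_cod t = ab_cod s"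
  by (induction rule: ab_eq.induct) (auto simp: ab_typed_iff)

lemma ab_class_eq:
  assumes "ab_eq t s"
  shows "ab_class t = ab_class s"
proof -
  have "ab_eq s t" using assms by (rule ab_eq.sym)
  with assms show ?thesis
    unfolding ab_class_def by (blast intro: ab_eq.trans)
qed

lemma ab_class_self: "ab_typed t m n \<Longrightarrow> t \<in> ab_class t"
  by (simp add: ab_class_def ab_eq.refl)

lemma AB_simps [simp]:
  "Ob AB = UNIV" "Arr AB m n = {ab_class t | t. ab_typed t m n}"
  "zero_mor AB m n = ab_class (Zero m n)" "ident AB n = ab_class (Idt n)"
  "unit_ob AB = 0" "tens_ob AB = (+)"
  by (simp_all add: AB_def mk_module_def)

lemma UN_ab_class:
  assumes t: "ab_typed t m n" and f: "\<And>t'. ab_eq t t' \<Longrightarrow> f t' = c"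
  shows "(\<Union>t'\<in>ab_class t. f t') = c"
proof (rule SUP_eq_const)
  show "ab_class t \<noteq> {}" using ab_class_self [OF t] by blast
  show "f t' = c" if "t' \<in> ab_class t" for t'
    using that by (intro f) (simp add: ab_class_def)
qed

lemma AB_cmp:
  assumes "ab_typed t l m" "ab_typed s m n"
  shows "cmp AB (ab_class s) (ab_class t) = ab_class (Cmp s t)"
proof -
  have "ab_class (Cmp s' t') = ab_class (Cmp s t)" if "ab_eq s s'" "ab_eq t t'" for s' t'
  proof -
    have "ab_eq (Cmp s t) (Cmp s' t')"
      using assms that by (intro ab_eq.Cmp_cong [of s t l n] ab_typed.intros(6))
    then show ?thesis by (rule ab_class_eq [OF ab_eq.sym])
  qed
  then show ?thesis
    using assms by (simp add: AB_def UN_ab_class)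
qed

lemma AB_tens [simp]:
  assumes "ab_typed t m n" "ab_typed s m' n'"
  shows "tens_mor AB (ab_class t) (ab_class s) = ab_class (Tens t s)"
proof -
  have "ab_class (Tens t' s') = ab_class (Tens t s)" if "ab_eq s s'" "ab_eq t t'" for s' t'
    by (rule ab_class_eq [OF ab_eq.sym [OF ab_eq.Tens_cong]]) fact+
  then show ?thesis
    using assms by (simp add: AB_def UN_ab_class)
qed

lemma AB_add [simp]:
  assumes "ab_typed t m n" "ab_typed s m n"
  shows "ab_class t \<oplus>\<^bsub>Hom AB m n\<^esub> ab_class s = ab_class (Plus t s)"
proof -
  have "ab_class (Plus t' s') = ab_class (Plus t s)" if "ab_eq s s'" "ab_eq t t'" for s' t'
  proof -
    have "ab_eq (Plus t s) (Plus t' s')"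
      using assms that by (intro ab_eq.Plus_cong [of t s m n] ab_typed.intros(9))
    then show ?thesis by (rule ab_class_eq [OF ab_eq.sym])
  qed
  then show ?thesis
    using assms by (simp add: AB_def mk_module_def UN_ab_class)
qed

lemma AB_smult [simp]:
  assumes "ab_typed t m n"
  shows "a \<odot>\<^bsub>Hom AB m n\<^esub> ab_class t = ab_class (Scale a t)"
proof -
  have "ab_class (Scale a t') = ab_class (Scale a t)" if "ab_eq t t'" for t'
    by (rule ab_class_eq [OF ab_eq.sym [OF ab_eq.Scale_cong]]) fact
  then show ?thesis
    using assms by (simp add: AB_def mk_module_def UN_ab_class)
qed

lemma ab_class_in: "ab_typed t m n \<Longrightarrow> ab_class t \<in> Arr AB m n"
  by auto

lemma AB_hom_vector_space: "vector_space_over_k (Hom (AB :: (nat, 'k::field ab_mor, 'k) moncat) m n)"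
proof (rule moduleI)
  let ?H = "Hom (AB :: (nat, 'k ab_mor, 'k) moncat) m n"
  show "cring (scalars :: 'k ring)" by (rule cring_from_type_algebra)
  show "abelian_group ?H"
  proof (rule abelian_groupI)
    show "\<zero>\<^bsub>?H\<^esub> \<in> carrier ?H" by (auto intro: ab_typed.intros)
  next
    fix f g assume "f \<in> carrier ?H" "g \<in> carrier ?H"
    then obtain s t where t: "f = ab_class s" "ab_typed s m n" "g = ab_class t" "ab_typed t m n" by auto
    show "f \<oplus>\<^bsub>?H\<^esub> g \<in> carrier ?H"
      using ab_class_in [OF ab_typed.intros(9) [OF t(2,4)]] t by (simp only: AB_add)
    show "f \<oplus>\<^bsub>?H\<^esub> g = g \<oplus>\<^bsub>?H\<^esub> f"
      using t ab_class_eq [OF ab_eq.Plus_commute [OF ab_typed.intros(9) [OF t(2,4)]]] by simp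
    fix h assume "h \<in> carrier ?H"
    then obtain r where r: "h = ab_class r" "ab_typed r m n" by auto
    show "f \<oplus>\<^bsub>?H\<^esub> g \<oplus>\<^bsub>?H\<^esub> h = f \<oplus>\<^bsub>?H\<^esub> (g \<oplus>\<^bsub>?H\<^esub> h)"
      using t r ab_class_eq [OF ab_eq.Plus_assoc [OF ab_typed.intros(9)
          [OF ab_typed.intros(9) [OF t(2,4)] r(2)]]]
      by (simp add: ab_typed.intros)
  next
    fix f assume "f \<in> carrier ?H"
    then obtain t where t: "f = ab_class t" "ab_typed t m n" by auto
    have "ab_eq (Plus (Zero m n) t) t"
      by (rule ab_eq.trans [OF ab_eq.Plus_commute ab_eq.Plus_Zero])
         (use t in \<open>auto intro: ab_typed.intros\<close>)
    then show "\<zero>\<^bsub>?H\<^esub> \<oplus>\<^bsub>?H\<^esub> f = f"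
      using t by (simp add: ab_class_eq ab_typed.intros)
    have "ab_eq (Plus (Scale (-1) t) t) (Zero m n)"
      by (rule ab_eq.trans [OF ab_eq.Plus_commute ab_eq.Minus_self])
         (use t in \<open>auto intro: ab_typed.intros\<close>)
    then show "\<exists>g\<in>carrier ?H. g \<oplus>\<^bsub>?H\<^esub> f = \<zero>\<^bsub>?H\<^esub>"
      using t by (intro bexI [of _ "ab_class (Scale (-1) t)"])
        (auto simp: ab_class_eq ab_typed.intros intro: ab_typed.intros)
  qed
next
  let ?H = "Hom (AB :: (nat, 'k ab_mor, 'k) moncat) m n"
  fix a :: 'k and f g assume "f \<in> carrier ?H" "g \<in> carrier ?H"
  then obtain s t where t: "f = ab_class s" "ab_typed s m n" "g = ab_class t" "ab_typed t m n" by auto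
  show "a \<odot>\<^bsub>?H\<^esub> (f \<oplus>\<^bsub>?H\<^esub> g) = a \<odot>\<^bsub>?H\<^esub> f \<oplus>\<^bsub>?H\<^esub> a \<odot>\<^bsub>?H\<^esub> g"
    using t ab_class_eq [OF ab_eq.Scale_Plus [OF ab_typed.intros(9) [OF t(2,4)], of a]]
    by (simp add: ab_typed.intros)
next
  let ?H = "Hom (AB :: (nat, 'k ab_mor, 'k) moncat) m n"
  fix a b :: 'k and f assume "f \<in> carrier ?H"
  then obtain t where t: "f = ab_class t" "ab_typed t m n" by auto
  show "a \<odot>\<^bsub>?H\<^esub> f \<in> carrier ?H" 
    using ab_class_in [OF ab_typed.intros(10) [OF t(2)]] t by (simp only: AB_smult)
  show "(a \<oplus>\<^bsub>scalars\<^esub> b) \<odot>\<^bsub>?H\<^esub> f = a \<odot>\<^bsub>?H\<^esub> f \<oplus>\<^bsub>?H\<^esub> b \<odot>\<^bsub>?H\<^esub> f"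
    using t by (simp add: ab_class_eq [OF ab_eq.Scale_add] ab_typed.intros)
  show "(a \<otimes>\<^bsub>scalars\<^esub> b) \<odot>\<^bsub>?H\<^esub> f = a \<odot>\<^bsub>?H\<^esub> (b \<odot>\<^bsub>?H\<^esub> f)"
    using t by (simp add: ab_class_eq [OF ab_eq.Scale_mult] ab_typed.intros)
  show "\<one>\<^bsub>scalars\<^esub> \<odot>\<^bsub>?H\<^esub> f = f"
    using t by (simp add: ab_class_eq [OF ab_eq.Scale_one] ab_typed.intros)
qed

lemma AB_linear_category: "linear_category (AB :: (nat, 'k::field ab_mor, 'k) moncat)"
proof (rule linear_category.intro, goal_cases)
  case (1 m n)
  show ?case by (rule AB_hom_vector_space)
next
  case (2 m n m' n' f)
  then obtain t t' where t: "f = ab_class t" "ab_typed t m n" "f = ab_class t'" "ab_typed t' m' n'"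
    by auto
  then have "ab_eq t t'" using ab_class_self [OF t(4)] by (simp add: ab_class_def)
  then show ?case using t ab_eq_preserves_type by (auto simp: ab_typed_iff)
next
  case (3 m)
  show ?case by (auto intro: ab_typed.intros)
next
  case (4 l m n f g)
  then obtain t s where t: "f = ab_class t" "ab_typed t l m" "g = ab_class s" "ab_typed s m n"
    by auto
  then show ?case
    using ab_class_in [OF ab_typed.intros(6) [OF t(2,4)]] by (simp only: AB_cmp)
next
  case (5 m n f)
  then obtain t where t: "f = ab_class t" "ab_typed t m n" by auto
  then show ?case
    by (simp add: AB_cmp [OF _ ab_typed.intros(1)] ab_class_eq [OF ab_eq.Idt_left])
next
  case (6 m n f)
  then obtain t where t: "f = ab_class t" "ab_typed t m n" by auto
  then show ?case
    by (simp add: AB_cmp [OF ab_typed.intros(1)] ab_class_eq [OF ab_eq.Idt_right])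
next
  case (7 k l m n f g h)
  then obtain t s r where t: "f = ab_class t" "ab_typed t k l" "g = ab_class s" "ab_typed s l m"
    "h = ab_class r" "ab_typed r m n"
    by auto
  note st = ab_typed.intros(6) [OF t(2,4)] and rs = ab_typed.intros(6) [OF t(4,6)]
  show ?case
    unfolding t AB_cmp [OF t(2,4)] AB_cmp [OF t(4,6)] AB_cmp [OF st t(6)] AB_cmp [OF t(2) rs]
    by (rule ab_class_eq [OF ab_eq.sym [OF ab_eq.Cmp_assoc [OF ab_typed.intros(6) [OF t(2) rs]]]])
next
  case (8 l m n f)
  then obtain t where t: "f = ab_class t" "ab_typed t l m" by auto
  show ?case
    unfolding linear_map_def Pi_iff
  proof (intro conjI ballI allI)
    fix g assume "g \<in> Arr (AB :: (nat, 'k ab_mor, 'k) moncat) m n"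
    then obtain s where s: "g = ab_class s" "ab_typed s m n" by auto
    note st = ab_typed.intros(6) [OF t(2) s(2)]
    show "cmp AB g f \<in> Arr AB l n"
      unfolding s t AB_cmp [OF t(2) s(2)] by (rule ab_class_in [OF st])
    fix a
    show "cmp AB (a \<odot>\<^bsub>Hom AB m n\<^esub> g) f = a \<odot>\<^bsub>Hom AB l n\<^esub> cmp AB g f"
      unfolding s t AB_cmp [OF t(2) s(2)] AB_smult [OF s(2)] AB_smult [OF st]
        AB_cmp [OF t(2) ab_typed.intros(10) [OF s(2)]]
      by (rule ab_class_eq [OF ab_eq.Cmp_Scale_left [OF st]])
    fix h assume "h \<in> Arr (AB :: (nat, 'k ab_mor, 'k) moncat) m n"
    then obtain r where r: "h = ab_class r" "ab_typed r m n" by auto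
    note rt = ab_typed.intros(6) [OF t(2) r(2)] and sr = ab_typed.intros(9) [OF s(2) r(2)]
    show "cmp AB (g \<oplus>\<^bsub>Hom AB m n\<^esub> h) f = cmp AB g f \<oplus>\<^bsub>Hom AB l n\<^esub> cmp AB h f"
      unfolding r s t AB_add [OF s(2) r(2)] AB_cmp [OF t(2) s(2)] AB_cmp [OF t(2) r(2)]
        AB_add [OF st rt] AB_cmp [OF t(2) sr]
      by (rule ab_class_eq [OF ab_eq.Cmp_Plus_left [OF ab_typed.intros(6) [OF t(2) sr]]])
  qed
next
  case (9 l m n f)
  then obtain t where t: "f = ab_class t" "ab_typed t m n" by auto
  show ?case
    unfolding linear_map_def Pi_iff
  proof (intro conjI ballI allI)
    fix g assume "g \<in> Arr (AB :: (nat, 'k ab_mor, 'k) moncat) l m"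
    then obtain s where s: "g = ab_class s" "ab_typed s l m" by auto
    note ts = ab_typed.intros(6) [OF s(2) t(2)]
    show "cmp AB f g \<in> Arr AB l n"
      unfolding s t AB_cmp [OF s(2) t(2)] by (rule ab_class_in [OF ts])
    fix a
    show "cmp AB f (a \<odot>\<^bsub>Hom AB l m\<^esub> g) = a \<odot>\<^bsub>Hom AB l n\<^esub> cmp AB f g"
      unfolding s t AB_cmp [OF s(2) t(2)] AB_smult [OF s(2)] AB_smult [OF ts]
        AB_cmp [OF ab_typed.intros(10) [OF s(2)] t(2)]
      by (rule ab_class_eq [OF ab_eq.Cmp_Scale_right [OF ts]])
    fix h assume "h \<in> Arr (AB :: (nat, 'k ab_mor, 'k) moncat) l m"
    then obtain r where r: "h = ab_class r" "ab_typed r l m" by auto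
    note tr = ab_typed.intros(6) [OF r(2) t(2)] and sr = ab_typed.intros(9) [OF s(2) r(2)]
    show "cmp AB f (g \<oplus>\<^bsub>Hom AB l m\<^esub> h) = cmp AB f g \<oplus>\<^bsub>Hom AB l n\<^esub> cmp AB f h"
      unfolding r s t AB_add [OF s(2) r(2)] AB_cmp [OF s(2) t(2)] AB_cmp [OF r(2) t(2)]
        AB_add [OF ts tr] AB_cmp [OF sr t(2)]
      by (rule ab_class_eq [OF ab_eq.Cmp_Plus_right [OF ab_typed.intros(6) [OF sr t(2)]]])
  qed
qed

section \<open>Evaluation at an object of a module category\<close>

context AB_module_category
begin

lemma endofunctor_linear: "linear_functor R R (fob \<Phi> n)"
  using fob_in [of n] by (simp add: End_cat_def)

lemma act_ob_in [simp]: "X \<in> Ob R \<Longrightarrow> act_ob \<Phi> n X \<in> Ob R"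
  unfolding act_ob_def by (rule linear_functor.fob_in [OF endofunctor_linear])

text \<open>
  A morphism of the category of endofunctors is stored with its source and target; here they
  are recovered from the type of \<open>f\<close>.
\<close>

lemma fmor_triple:
  assumes "f \<in> Arr AB m n"
  shows "fmor \<Phi> f = (fob \<Phi> m, act_mor \<Phi> f, fob \<Phi> n)"
    and "natural_transformation R R (fob \<Phi> m) (fob \<Phi> n) (act_mor \<Phi> f)"
proof -
  have "fmor \<Phi> f \<in> Arr (End_cat R) (fob \<Phi> m) (fob \<Phi> n)"
    using fmor_linear [of m n] assms by (auto simp: linear_map_def)
  then obtain \<alpha> where \<alpha>: "fmor \<Phi> f = (fob \<Phi> m, \<alpha>, fob \<Phi> n)"
    "natural_transformation R R (fob \<Phi> m) (fob \<Phi> n) \<alpha>"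
    by (auto simp: End_cat_def mk_module_def)
  then have "act_mor \<Phi> f = \<alpha>" by (auto simp: act_mor_def)
  with \<alpha> show "fmor \<Phi> f = (fob \<Phi> m, act_mor \<Phi> f, fob \<Phi> n)"
    "natural_transformation R R (fob \<Phi> m) (fob \<Phi> n) (act_mor \<Phi> f)" by simp_all
qed

lemma act_mor_in:
  "f \<in> Arr AB m n \<Longrightarrow> X \<in> Ob R \<Longrightarrow> act_mor \<Phi> f X \<in> Arr R (act_ob \<Phi> m X) (act_ob \<Phi> n X)"
  using fmor_triple(2) unfolding natural_transformation_def act_ob_def by blast

lemma act_mor_natural:
  assumes "f \<in> Arr AB m n" "g \<in> Arr R X Y" "X \<in> Ob R" "Y \<in> Ob R"
  shows "cmp R (act_mor \<Phi> f Y) (fmor (fob \<Phi> m) g) = cmp R (fmor (fob \<Phi> n) g) (act_mor \<Phi> f X)"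
  using fmor_triple(2) [OF assms(1)] assms(2-4) unfolding natural_transformation_def by blast

lemma act_mor_add:
  assumes "f \<in> Arr AB m n" "g \<in> Arr AB m n" "X \<in> Ob R"
  shows "act_mor \<Phi> (f \<oplus>\<^bsub>Hom AB m n\<^esub> g) X
    = act_mor \<Phi> f X \<oplus>\<^bsub>Hom R (act_ob \<Phi> m X) (act_ob \<Phi> n X)\<^esub> act_mor \<Phi> g X"
proof -
  have "fmor \<Phi> (f \<oplus>\<^bsub>Hom AB m n\<^esub> g)
      = fmor \<Phi> f \<oplus>\<^bsub>Hom (End_cat R) (fob \<Phi> m) (fob \<Phi> n)\<^esub> fmor \<Phi> g"
    using fmor_linear [of m n] assms by (simp add: linear_map_def del: AB_simps(2))
  then show ?thesis
    unfolding act_mor_def [of _ "f \<oplus>\<^bsub>Hom AB m n\<^esub> g"] fmor_triple(1) [OF assms(1)] fmor_triple(1) [OF assms(2)]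
    using assms(3) by (simp add: End_cat_def mk_module_def act_ob_def)
qed

lemma act_mor_smult:
  assumes "f \<in> Arr AB m n" "X \<in> Ob R"
  shows "act_mor \<Phi> (a \<odot>\<^bsub>Hom AB m n\<^esub> f) X
    = a \<odot>\<^bsub>Hom R (act_ob \<Phi> m X) (act_ob \<Phi> n X)\<^esub> act_mor \<Phi> f X"
proof -
  have "fmor \<Phi> (a \<odot>\<^bsub>Hom AB m n\<^esub> f)
      = a \<odot>\<^bsub>Hom (End_cat R) (fob \<Phi> m) (fob \<Phi> n)\<^esub> fmor \<Phi> f"
    using fmor_linear [of m n] assms by (simp add: linear_map_def del: AB_simps(2))
  then show ?thesis
    unfolding act_mor_def [of _ "a \<odot>\<^bsub>Hom AB m n\<^esub> f"] fmor_triple(1) [OF assms(1)]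
    using assms(2) by (simp add: End_cat_def mk_module_def act_ob_def)
qed

lemma act_mor_ident:
  assumes "X \<in> Ob R"
  shows "act_mor \<Phi> (ident AB n) X = ident R (act_ob \<Phi> n X)"
  using fmor_ident [of n] assms by (simp add: act_mor_def End_cat_def act_ob_def del: AB_simps(4))

lemma act_mor_cmp:
  assumes "f \<in> Arr AB l m" "g \<in> Arr AB m n" "X \<in> Ob R"
  shows "act_mor \<Phi> (cmp AB g f) X = cmp R (act_mor \<Phi> g X) (act_mor \<Phi> f X)"
  unfolding act_mor_def [of _ "cmp AB g f"]
  using fmor_cmp [of l m n f g] assms
  by (simp add: fmor_triple(1) [OF assms(1)] fmor_triple(1) [OF assms(2)] End_cat_def
      del: AB_simps(2))

lemma act_mor_tens:
  assumes "f \<in> Arr AB m n" "g \<in> Arr AB m' n'" "X \<in> Ob R"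
  shows "act_mor \<Phi> (tens_mor AB f g) X
    = cmp R (act_mor \<Phi> f (act_ob \<Phi> n' X)) (fmor (fob \<Phi> m) (act_mor \<Phi> g X))"
  unfolding act_mor_def [of _ "tens_mor AB f g"]
  using fmor_tens [of m n m' n' f g] assms
  by (simp add: fmor_triple(1) [OF assms(1)] fmor_triple(1) [OF assms(2)] End_cat_def act_ob_def
      del: AB_simps(2))

lemma act_ob_0 [simp]: "X \<in> Ob R \<Longrightarrow> act_ob \<Phi> 0 X = X"
  using fob_unit by (simp add: act_ob_def End_cat_def id_functor_def)

lemma act_ob_add: "X \<in> Ob R \<Longrightarrow> act_ob \<Phi> (m + n) X = act_ob \<Phi> m (act_ob \<Phi> n X)"
  using fob_tens [of m n] by (simp add: act_ob_def End_cat_def cmp_functor_def)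

lemma fmor_fob_0: "f \<in> arrows R \<Longrightarrow> fmor (fob \<Phi> 0) f = f"
  using fob_unit by (simp add: End_cat_def id_functor_def)

lemma fmor_fob_add: "f \<in> arrows R \<Longrightarrow> fmor (fob \<Phi> (m + n)) f = fmor (fob \<Phi> m) (fmor (fob \<Phi> n) f)"
  using fob_tens [of m n] by (simp add: End_cat_def cmp_functor_def)

text \<open>
  Evaluation at a fixed object is a linear functor, so it carries sums, powers and
  polynomials formed in the affine Brauer category to those formed in \<open>R\<close>.
\<close>

lemma evaluation_functor:
  assumes "X \<in> Ob R"
  shows "linear_functor AB R \<lparr>fob = (\<lambda>n. act_ob \<Phi> n X), fmor = (\<lambda>f. act_mor \<Phi> f X)\<rparr>"
proof (rule linear_functor.intro, goal_cases)
  case (2 m n)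
  show ?case
    unfolding linear_map_def using assms
    by (simp add: Pi_iff act_mor_in act_mor_add act_mor_smult del: AB_simps(2))
qed (use assms in \<open>simp_all add: act_mor_ident act_mor_cmp del: AB_simps(2,4)\<close>)

abbreviation act_term :: "'k ab_term \<Rightarrow> 'o \<Rightarrow> 'm"
  where "act_term t X \<equiv> act_mor \<Phi> (ab_class t) X"

lemma act_term_Cmp:
  assumes "ab_typed t l m" "ab_typed s m n" "X \<in> Ob R"
  shows "act_term (Cmp s t) X = cmp R (act_term s X) (act_term t X)"
  using act_mor_cmp [OF ab_class_in [OF assms(1)] ab_class_in [OF assms(2)] assms(3)]
  by (simp only: AB_cmp [OF assms(1,2)])

lemma act_term_Tens:
  assumes "ab_typed t m n" "ab_typed s m' n'" "X \<in> Ob R"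
  shows "act_term (Tens t s) X
    = cmp R (act_term t (act_ob \<Phi> n' X)) (fmor (fob \<Phi> m) (act_term s X))"
  using act_mor_tens [OF ab_class_in [OF assms(1)] ab_class_in [OF assms(2)] assms(3)]
  by (simp only: AB_tens [OF assms(1,2)])

lemma act_term_Minus:
  assumes "ab_typed t m n" "ab_typed s m n" "X \<in> Ob R"
  shows "act_term (Minus t s) X
    = act_term t X \<oplus>\<^bsub>Hom R (act_ob \<Phi> m X) (act_ob \<Phi> n X)\<^esub>
      (- 1) \<odot>\<^bsub>Hom R (act_ob \<Phi> m X) (act_ob \<Phi> n X)\<^esub> act_term s X"
  using act_mor_add [OF ab_class_in [OF assms(1)] ab_class_in [OF ab_typed.intros(10) [OF assms(2)]] assms(3)]
    act_mor_smult [OF ab_class_in [OF assms(2)] assms(3)] assms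
  by (simp add: ab_typed.intros)

lemma act_term_Scale:
  assumes "ab_typed t m n" "X \<in> Ob R"
  shows "act_term (Scale a t) X = a \<odot>\<^bsub>Hom R (act_ob \<Phi> m X) (act_ob \<Phi> n X)\<^esub> act_term t X"
  using act_mor_smult [OF ab_class_in [OF assms(1)] assms(2)] assms by simp

lemma act_term_Idt: "X \<in> Ob R \<Longrightarrow> act_term (Idt n) X = ident R (act_ob \<Phi> n X)"
  using act_mor_ident by simp

sublocale endofunctor: linear_endofunctor R "fob \<Phi> 1"
  by (intro linear_endofunctor.intro endofunctor_linear linear_category_axioms)

abbreviation B :: "'o \<Rightarrow> 'o" where "B \<equiv> fob (fob \<Phi> 1)"

lemma act_ob_1: "act_ob \<Phi> 1 X = B X"
  by (simp add: act_ob_def)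

lemma act_ob_2: "X \<in> Ob R \<Longrightarrow> act_ob \<Phi> 2 X = B (B X)"
  using act_ob_add [of X 1 1] by (simp add: act_ob_def numeral_2_eq_2)

lemma fmor_fob_2: "f \<in> arrows R \<Longrightarrow> fmor (fob \<Phi> 2) f = fmor (fob \<Phi> 1) (fmor (fob \<Phi> 1) f)"
  using fmor_fob_add [of f 1 1] by (simp add: numeral_2_eq_2)

lemma generator_in:
  assumes "X \<in> Ob R"
  shows "act_term Cap X \<in> Arr R (B (B X)) X" "act_term Cup X \<in> Arr R X (B (B X))"
    "act_term Swap X \<in> Arr R (B (B X)) (B (B X))" "act_term Dot X \<in> Arr R (B X) (B X)"
  using act_mor_in [OF ab_class_in [OF ab_typed.intros(2)] assms]
    act_mor_in [OF ab_class_in [OF ab_typed.intros(3)] assms]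
    act_mor_in [OF ab_class_in [OF ab_typed.intros(4)] assms]
    act_mor_in [OF ab_class_in [OF ab_typed.intros(5)] assms] assms
  by (simp_all add: act_ob_2 act_ob_1 del: One_nat_def)

lemma generator_arrows:
  assumes "X \<in> Ob R"
  shows "act_term Cap X \<in> arrows R" "source R (act_term Cap X) = B (B X)" "target R (act_term Cap X) = X"
    and "act_term Cup X \<in> arrows R" "source R (act_term Cup X) = X" "target R (act_term Cup X) = B (B X)"
    and "act_term Swap X \<in> arrows R" "source R (act_term Swap X) = B (B X)"
      "target R (act_term Swap X) = B (B X)"
    and "act_term Dot X \<in> arrows R" "source R (act_term Dot X) = B X" "target R (act_term Dot X) = B X"
  using ArrD [OF generator_in(1)] ArrD [OF generator_in(2)] ArrD [OF generator_in(3)]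
    ArrD [OF generator_in(4)] endofunctor.fob_in assms by simp_all

lemma generator_typed:
  "ab_typed Cap 2 0" "ab_typed Cup 0 2" "ab_typed Swap 2 2" "ab_typed Dot 1 1" "ab_typed (Idt n) n n"
  "ab_typed (Tens Cap (Idt 1)) 3 1" "ab_typed (Tens (Idt 1) Cap) 3 1"
  "ab_typed (Tens Cup (Idt 1)) 1 3" "ab_typed (Tens (Idt 1) Cup) 1 3"
  "ab_typed (Tens Swap (Idt 1)) 3 3" "ab_typed (Tens (Idt 1) Swap) 3 3"
  "ab_typed (Tens Dot (Idt 1)) 2 2" "ab_typed (Tens (Idt 1) Dot) 2 2"
  "ab_typed (Cmp (Tens Dot (Idt 1)) Swap) 2 2" "ab_typed (Cmp Swap (Tens (Idt 1) Dot)) 2 2"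
  "ab_typed (Cmp Cup Cap) 2 2" "ab_typed (Cmp Cap (Tens (Idt 1) Dot)) 2 0"
  by (simp_all add: ab_typed_iff)

lemma tensor_right_identity:
  assumes X: "X \<in> Ob R"
  shows "act_term (Tens Cap (Idt 1)) X = act_term Cap (B X)"
    "act_term (Tens Cup (Idt 1)) X = act_term Cup (B X)"
    "act_term (Tens Swap (Idt 1)) X = act_term Swap (B X)"
    "act_term (Tens Dot (Idt 1)) X = act_term Dot (B X)"
proof -
  note [simp] = act_ob_1 act_ob_2 fmor_fob_2 fmor_fob_0 generator_arrows X
    endofunctor.fob_in
  note [simp del] = One_nat_def
  show "act_term (Tens Cap (Idt 1)) X = act_term Cap (B X)"
    by (simp add: act_term_Tens [OF generator_typed(1) generator_typed(5)] act_term_Idt)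
  show "act_term (Tens Cup (Idt 1)) X = act_term Cup (B X)"
    by (simp add: act_term_Tens [OF generator_typed(2) generator_typed(5)] act_term_Idt)
  show "act_term (Tens Swap (Idt 1)) X = act_term Swap (B X)"
    by (simp add: act_term_Tens [OF generator_typed(3) generator_typed(5)] act_term_Idt)
  show "act_term (Tens Dot (Idt 1)) X = act_term Dot (B X)"
    by (simp add: act_term_Tens [OF generator_typed(4) generator_typed(5)] act_term_Idt)
qed

lemma tensor_left_identity:
  assumes X: "X \<in> Ob R"
  shows "act_term (Tens (Idt 1) Cap) X = fmor (fob \<Phi> 1) (act_term Cap X)"
    "act_term (Tens (Idt 1) Cup) X = fmor (fob \<Phi> 1) (act_term Cup X)"
    "act_term (Tens (Idt 1) Swap) X = fmor (fob \<Phi> 1) (act_term Swap X)"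
    "act_term (Tens (Idt 1) Dot) X = fmor (fob \<Phi> 1) (act_term Dot X)"
proof -
  note [simp] = act_ob_1 act_ob_2 fmor_fob_2 fmor_fob_0 generator_arrows X
    endofunctor.fob_in
  note [simp del] = One_nat_def
  show "act_term (Tens (Idt 1) Cap) X = fmor (fob \<Phi> 1) (act_term Cap X)"
    by (simp add: act_term_Tens [OF generator_typed(5) generator_typed(1)] act_term_Idt)
  show "act_term (Tens (Idt 1) Cup) X = fmor (fob \<Phi> 1) (act_term Cup X)"
    by (simp add: act_term_Tens [OF generator_typed(5) generator_typed(2)] act_term_Idt)
  show "act_term (Tens (Idt 1) Swap) X = fmor (fob \<Phi> 1) (act_term Swap X)"
    by (simp add: act_term_Tens [OF generator_typed(5) generator_typed(3)] act_term_Idt)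
  show "act_term (Tens (Idt 1) Dot) X = fmor (fob \<Phi> 1) (act_term Dot X)"
    by (simp add: act_term_Tens [OF generator_typed(5) generator_typed(4)] act_term_Idt)
qed

lemma generator_natural:
  assumes "f \<in> arrows R"
  shows "cmp R (act_term Cap (target R f)) (fmor (fob \<Phi> 1) (fmor (fob \<Phi> 1) f))
      = cmp R f (act_term Cap (source R f))"
    and "cmp R (act_term Cup (target R f)) f
      = cmp R (fmor (fob \<Phi> 1) (fmor (fob \<Phi> 1) f)) (act_term Cup (source R f))"
    and "cmp R (act_term Swap (target R f)) (fmor (fob \<Phi> 1) (fmor (fob \<Phi> 1) f))
      = cmp R (fmor (fob \<Phi> 1) (fmor (fob \<Phi> 1) f)) (act_term Swap (source R f))"
    and "cmp R (act_term Dot (target R f)) (fmor (fob \<Phi> 1) f)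
      = cmp R (fmor (fob \<Phi> 1) f) (act_term Dot (source R f))"
  using act_mor_natural [OF ab_class_in [OF ab_typed.intros(2)] arrowsD [OF assms]]
    act_mor_natural [OF ab_class_in [OF ab_typed.intros(3)] arrowsD [OF assms]]
    act_mor_natural [OF ab_class_in [OF ab_typed.intros(4)] arrowsD [OF assms]]
    act_mor_natural [OF ab_class_in [OF ab_typed.intros(5)] arrowsD [OF assms]]
  by (simp_all add: fmor_fob_0 fmor_fob_2 assms del: One_nat_def)

sublocale brauer: brauer_endofunctor R "fob \<Phi> 1"
  "act_term Cap" "act_term Cup" "act_term Swap" "act_term Dot"
proof (intro brauer_endofunctor.intro brauer_endofunctor_axioms.intro
    endofunctor.linear_endofunctor_axioms generator_in generator_natural; assumption?)
  fix X assume X: "X \<in> Ob R"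
  note [simp] = act_term_Cmp [OF generator_typed(8,7) X] act_term_Cmp [OF generator_typed(9,6) X]
    act_term_Cmp [OF generator_typed(3,1) X] act_term_Cmp [OF generator_typed(10,7) X]
    act_term_Cmp [OF generator_typed(11,6) X] act_term_Cmp [OF generator_typed(3,12) X]
    act_term_Cmp [OF generator_typed(13,3) X] act_term_Cmp [OF generator_typed(1,2) X]
    act_term_Cmp [OF generator_typed(12,1) X] act_term_Cmp [OF generator_typed(13,1) X]
    tensor_left_identity [OF X] tensor_right_identity [OF X] act_term_Idt [OF X]
    act_ob_1 act_ob_2 [OF X] act_ob_0 [OF X]
    act_term_Minus [OF generator_typed(14,15) X] act_term_Minus [OF generator_typed(5,16) X]
    act_term_Scale [OF generator_typed(17) X]
  note [simp del] = One_nat_def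
  show "cmp R (fmor (fob \<Phi> 1) (act_term Cap X)) (act_term Cup (B X)) = ident R (B X)"
    using ab_class_eq [OF ab_eq.zigzag_left, THEN arg_cong, of "\<lambda>f. act_mor \<Phi> f X"] by simp
  show "cmp R (act_term Cap (B X)) (fmor (fob \<Phi> 1) (act_term Cup X)) = ident R (B X)"
    using ab_class_eq [OF ab_eq.zigzag_right, THEN arg_cong, of "\<lambda>f. act_mor \<Phi> f X"] by simp
  show "cmp R (act_term Cap X) (act_term Swap X) = act_term Cap X"
    using ab_class_eq [OF ab_eq.Cap_Swap, THEN arg_cong, of "\<lambda>f. act_mor \<Phi> f X"] by simp
  show "cmp R (fmor (fob \<Phi> 1) (act_term Cap X)) (act_term Swap (B X))
      = cmp R (act_term Cap (B X)) (fmor (fob \<Phi> 1) (act_term Swap X))"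
    using ab_class_eq [OF ab_eq.Cap_slide, THEN arg_cong, of "\<lambda>f. act_mor \<Phi> f X"] by simp
  show "cmp R (act_term Dot (B X)) (act_term Swap X) \<oplus>\<^bsub>Hom R (B (B X)) (B (B X))\<^esub>
        (- 1) \<odot>\<^bsub>Hom R (B (B X)) (B (B X))\<^esub> cmp R (act_term Swap X) (fmor (fob \<Phi> 1) (act_term Dot X))
      = ident R (B (B X)) \<oplus>\<^bsub>Hom R (B (B X)) (B (B X))\<^esub>
        (- 1) \<odot>\<^bsub>Hom R (B (B X)) (B (B X))\<^esub> cmp R (act_term Cup X) (act_term Cap X)"
    using ab_class_eq [OF ab_eq.Dot_Swap, THEN arg_cong, of "\<lambda>f. act_mor \<Phi> f X"] by simp
  show "cmp R (act_term Cap X) (act_term Dot (B X))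
      = (- 1) \<odot>\<^bsub>Hom R (B (B X)) X\<^esub> cmp R (act_term Cap X) (fmor (fob \<Phi> 1) (act_term Dot X))"
    using ab_class_eq [OF ab_eq.Cap_Dot, THEN arg_cong, of "\<lambda>f. act_mor \<Phi> f X"] by simp
qed

abbreviation dot :: "'o \<Rightarrow> 'm" where "dot X \<equiv> act_term Dot X"

lemma act_dot_power:
  assumes "X \<in> Ob R"
  shows "act_mor \<Phi> (cat_power AB 1 (ab_class Dot) n) X = cat_power R (B X) (dot X) n"
  using linear_functor_cat_power [OF AB_linear_category evaluation_functor [OF assms]
      ab_class_in [OF generator_typed(4)]] by (simp add: act_ob_1 del: One_nat_def)

lemma act_dot_poly:
  assumes "X \<in> Ob R"
  shows "act_mor \<Phi> (cat_poly AB 1 (ab_class Dot) p) X = cat_poly R (B X) (dot X) p"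
  using linear_functor_cat_poly [OF AB_linear_category linear_category_axioms
      evaluation_functor [OF assms] ab_class_in [OF generator_typed(4)]]
  by (simp add: act_ob_1 del: One_nat_def)

text \<open>
  A power of the dot is only known as a class, so a representing term is chosen before
  the bubble is evaluated.
\<close>

lemma bubble_term:
  obtains t where "bubble n = ab_class t" "ab_typed t 0 0"
    "\<And>X. X \<in> Ob R \<Longrightarrow> act_term t X = brauer.closure X (cat_power R (B X) (dot X) n)"
proof -
  have "cat_power AB 1 (ab_class Dot) n \<in> Arr (AB :: (nat, 'k ab_mor, 'k) moncat) 1 1"
    by (rule linear_category.cat_power_in [OF AB_linear_category ab_class_in [OF generator_typed(4)]])
       simp
  then obtain d where d: "cat_power AB 1 (ab_class Dot) n = ab_class (d :: 'k ab_term)"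
    "ab_typed d 1 1"
    by auto
  have d2: "ab_typed (Tens (Idt 1) d) 2 2" "ab_typed (Cmp (Tens (Idt 1) d) Cup) 0 2"
    "ab_typed (Cmp Cap (Cmp (Tens (Idt 1) d) Cup)) 0 0"
    using d(2) by (simp_all add: ab_typed_iff)
  show thesis
  proof (rule that [OF _ d2(3)])
    show "bubble n = ab_class (Cmp Cap (Cmp (Tens (Idt 1) d) Cup))"
      by (simp add: bubble_def d(1) AB_tens [OF generator_typed(5) d(2)]
          AB_cmp [OF generator_typed(2) d2(1)] AB_cmp [OF d2(2) generator_typed(1)] del: One_nat_def)
    fix X assume X: "X \<in> Ob R"
    have dX: "act_term d X = cat_power R (B X) (dot X) n"
      using act_dot_power [OF X, of n] by (simp only: d(1))
    have "cat_power R (B X) (dot X) n \<in> Arr R (B X) (B X)"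
      using X by (intro cat_power_in generator_in endofunctor.fob_in)
    note [simp] = ArrD [OF this endofunctor.fob_in [OF X] endofunctor.fob_in [OF X]]
    show "act_term (Cmp Cap (Cmp (Tens (Idt 1) d) Cup)) X
        = brauer.closure X (cat_power R (B X) (dot X) n)"
      using X
      by (simp add: act_term_Cmp [OF d2(2) generator_typed(1)] act_term_Cmp [OF generator_typed(2) d2(1)]
          act_term_Tens [OF generator_typed(5) d(2)] dX act_term_Idt act_ob_1 brauer.closure_def
          del: One_nat_def)
  qed
qed

lemma act_bubble:
  assumes "X \<in> Ob R"
  shows "act_mor \<Phi> (bubble n) X = brauer.closure X (cat_power R (B X) (dot X) n)"
  using bubble_term [of n] assms by metis

lemma bubble_in: "bubble n \<in> Arr (AB :: (nat, 'k ab_mor, 'k) moncat) 0 0"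
  using bubble_term [of n] ab_class_in by metis

lemma act_beta_r:
  assumes X: "X \<in> Ob R"
    and b: "\<And>j. act_mor \<Phi> (bubble j) X = b j \<odot>\<^bsub>Hom R X X\<^esub> ident R X"
  shows "act_mor \<Phi> (beta_r n) X =
    ((if n = 0 then 1 else 0) + (\<Sum>j<n. fls_nth (2 * uu / (2 * uu - 1)) (int (n - 1 - j)) * b j))
      \<odot>\<^bsub>Hom R X X\<^esub> ident R X"
proof -
  let ?E = "Hom (AB :: (nat, 'k ab_mor, 'k) moncat) 0 0" and ?H = "Hom R X X"
  define w where "w j = (fls_nth (2 * uu / (2 * uu - 1)) (int (n - 1 - j)) :: 'k)" for j
  interpret AB: linear_category "AB :: (nat, 'k ab_mor, 'k) moncat" by (rule AB_linear_category)
  interpret ev: linear_functor AB R "\<lparr>fob = (\<lambda>n. act_ob \<Phi> n X), fmor = (\<lambda>f. act_mor \<Phi> f X)\<rparr>"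
    by (rule evaluation_functor [OF X])
  interpret E: Module.module scalars ?E by (rule AB_hom_vector_space)
  interpret H: Module.module scalars ?H by (rule hom_vector_space [OF X X])
  have act: "linear_map ?E ?H (\<lambda>f. act_mor \<Phi> f X)"
    using ev.fmor_linear [of 0 0] X by simp
  have id: "ident R X \<in> carrier ?H" by (rule ident_in [OF X])
  have terms: "w j \<odot>\<^bsub>?E\<^esub> bubble j \<in> carrier ?E" for j
    by (intro E.smult_closed bubble_in) simp
  have act_terms: "act_mor \<Phi> (w j \<odot>\<^bsub>?E\<^esub> bubble j) X = (w j * b j) \<odot>\<^bsub>?H\<^esub> ident R X" for j
    using linear_mapD(3) [OF act bubble_in] H.smult_assoc1 [of "w j" "b j", OF _ _ id]
    by (simp add: b)
  have finsum_scalars: "finsum ?H (\<lambda>j. c j \<odot>\<^bsub>?H\<^esub> ident R X) J = sum c J \<odot>\<^bsub>?H\<^esub> ident R X"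
    if "finite J" for c and J :: "nat set"
    using that
  proof (induction J)
    case empty
    show ?case using H.smult_l_null [OF id] by simp
  next
    case (insert j J)
    then show ?case
      using H.smult_l_distr [of "c j" "sum c J", OF _ _ id] H.smult_closed [OF _ id]
      by (simp add: H.finsum_insert)
  qed
  have "act_mor \<Phi> (finsum ?E (\<lambda>j. w j \<odot>\<^bsub>?E\<^esub> bubble j) {..<n}) X
      = finsum ?H (\<lambda>j. (w j * b j) \<odot>\<^bsub>?H\<^esub> ident R X) {..<n}"
    using terms
    by (subst linear_map_finsum [OF AB_hom_vector_space hom_vector_space [OF X X] act])
       (auto simp: act_terms)
  also have "\<dots> = (\<Sum>j<n. w j * b j) \<odot>\<^bsub>?H\<^esub> ident R X"
    by (simp add: finsum_scalars)
  finally have sum: "act_mor \<Phi> (finsum ?E (\<lambda>j. w j \<odot>\<^bsub>?E\<^esub> bubble j) {..<n}) X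
      = (\<Sum>j<n. w j * b j) \<odot>\<^bsub>?H\<^esub> ident R X" .
  have first: "act_mor \<Phi> (if n = 0 then ident AB 0 else zero_mor AB 0 0) X
      = (if n = 0 then 1 else 0) \<odot>\<^bsub>?H\<^esub> ident R X"
    using act_mor_ident [OF X, of 0] X H.smult_one [OF id] H.smult_l_null [OF id]
      linear_map_zero [OF AB_hom_vector_space hom_vector_space [OF X X] act]
    by (simp del: AB_simps)
  have closed: "(if n = 0 then ident AB 0 else zero_mor AB 0 0) \<in> carrier ?E"
    using AB.ident_in [of 0] by (simp del: AB_simps(2-6))
  have "finsum ?E (\<lambda>j. w j \<odot>\<^bsub>?E\<^esub> bubble j) {..<n} \<in> carrier ?E"
    using terms by (intro E.finsum_closed) blast
  from linear_mapD(2) [OF act closed this]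
  have "act_mor \<Phi> (beta_r n) X = (if n = 0 then 1 else 0) \<odot>\<^bsub>?H\<^esub> ident R X
      \<oplus>\<^bsub>?H\<^esub> (\<Sum>j<n. w j * b j) \<odot>\<^bsub>?H\<^esub> ident R X"
    by (simp only: beta_r_def sum first flip: w_def)
  also have "\<dots> = ((if n = 0 then 1 else 0) + (\<Sum>j<n. w j * b j)) \<odot>\<^bsub>?H\<^esub> ident R X"
    using H.smult_l_distr [of "if n = 0 then 1 else 0" "\<Sum>j<n. w j * b j", OF _ _ id]
    by (simp only: scalars_simps UNIV_I simp_thms)
  finally show ?thesis by (simp only: w_def)
qed

text \<open>
  The brick property makes each bubble act by a scalar \<open>b n\<close>, so that the curl on \<open>L\<close> is governed by
  \<^const>\<open>curl_poly\<close>. Since the minimal polynomial acts as zero on the strand next to \<open>L\<close>, the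
  curl and the bubbles decorated with its multiples vanish; these are the two hypotheses of
  \<open>curl_divisibility_determines_series\<close>.
\<close>

lemma O_series_eq_O_rational:
  assumes two: "(2 :: 'k) \<noteq> 0" and L: "brick R L" and m: "is_dot_minpoly R \<Phi> L m"
  shows "fps_to_fls (O_series R \<Phi> L) = O_rational m"
proof -
  have [simp]: "L \<in> Ob R"
    and bij: "bij_betw (\<lambda>c. c \<odot>\<^bsub>Hom R L L\<^esub> ident R L) UNIV (Arr R L L)"
    using L by (simp_all add: brick_def)
  let ?ev = "cat_poly R (B L) (dot L)"
  have dvd: "m dvd f \<longleftrightarrow> ?ev f = zero_mor R (B L) (B L)" for f
    using m by (auto simp: is_dot_minpoly_def dot_ideal_def act_dot_poly act_ob_1 simp del: One_nat_def)
  have power: "cat_power R (B L) (dot L) n \<in> Arr R (B L) (B L)" for n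
    by (intro cat_power_in generator_in endofunctor.fob_in) simp_all
  have "\<exists>c. brauer.closure L (cat_power R (B L) (dot L) n) = c \<odot>\<^bsub>Hom R L L\<^esub> ident R L" for n
  proof -
    have "brauer.closure L (cat_power R (B L) (dot L) n) \<in> Arr R L L"
      by (rule linear_mapD(1) [OF brauer.closure_linear power]) simp
    then show ?thesis
      using bij_betw_imp_surj_on [OF bij] by blast
  qed
  then obtain b where b:
    "\<And>n. brauer.closure L (cat_power R (B L) (dot L) n) = b n \<odot>\<^bsub>Hom R L L\<^esub> ident R L"
    by metis
  have coefficient: "fps_nth (O_series R \<Phi> L) n = (if n = 0 then 1 else 0) +
      (\<Sum>j<n. fls_nth (2 * uu / (2 * uu - 1)) (int (n - 1 - j)) * b j)" for n
  proof -
    have "act_mor \<Phi> (beta_r n) L = ((if n = 0 then 1 else 0) +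
        (\<Sum>j<n. fls_nth (2 * uu / (2 * uu - 1)) (int (n - 1 - j)) * b j)) \<odot>\<^bsub>Hom R L L\<^esub> ident R L"
      by (rule act_beta_r) (simp_all add: act_bubble b del: One_nat_def)
    then show ?thesis
      unfolding O_series_def using bij
      by (auto simp: bij_betw_def inj_def intro!: the_equality)
  qed
  then have "O_series R \<Phi> L = Abs_fps (\<lambda>n. (if n = 0 then 1 else 0) +
      (\<Sum>j<n. fls_nth (2 * uu / (2 * uu - 1)) (int (n - 1 - j)) * b j))"
    by (intro fps_ext) simp
  then have "fps_to_fls (O_series R \<Phi> L) = 1 + 2 * uu / (2 * uu - 1) * moment_series b 1"
    using series_of_beta_coefficients [OF two, of b] by simp
  also have "\<dots> = O_rational m"
  proof (rule curl_divisibility_determines_series [OF two])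
    show "Polynomial.lead_coeff m = 1" using m by (simp add: is_dot_minpoly_def)
    have "?ev (curl_poly b m) = brauer.curl L (?ev m)"
      by (rule brauer.curl_cat_poly [symmetric]) (simp_all add: b del: One_nat_def)
    also have "?ev m = zero_mor R (B L) (B L)" by (rule dvd [THEN iffD1]) simp
    also have "brauer.curl L \<dots> = zero_mor R (B L) (B L)"
      by (intro linear_map_zero hom_vector_space brauer.curl_linear endofunctor.fob_in) simp_all
    finally show "m dvd curl_poly b m" by (simp only: dvd)
    have "moment_functional (\<lambda>i. b (i + k)) m = 0" for k
    proof -
      have "moment_functional b (Polynomial.monom 1 k * m) \<odot>\<^bsub>Hom R L L\<^esub> ident R L
          = brauer.closure L (?ev (Polynomial.monom 1 k * m))"
        by (rule linear_map_cat_poly [OF generator_in(4) _ brauer.closure_linear hom_vector_space,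
              symmetric]) (simp_all add: b ident_in del: One_nat_def)
      also have "?ev (Polynomial.monom 1 k * m) = zero_mor R (B L) (B L)"
        by (rule dvd [THEN iffD1]) simp
      also have "brauer.closure L \<dots> = zero_mor R L L"
        by (intro linear_map_zero hom_vector_space brauer.closure_linear endofunctor.fob_in) simp_all
      also have "\<dots> = 0 \<odot>\<^bsub>Hom R L L\<^esub> ident R L"
      proof -
        interpret Module.module scalars "Hom R L L" by (rule hom_vector_space) simp_all
        show ?thesis using smult_l_null [of "ident R L"] by (simp add: ident_in)
      qed
      finally show ?thesis
        using bij by (simp add: bij_betw_def inj_def moment_functional_shift)
    qed
    then show "moment_series b m = 0" by (simp add: moment_series_def flip: fps_zero_def)
  qed
  finally show ?thesis .
qed

end

theorem theorem4p2:
  fixes R :: "('o, 'm, 'k::field) lincat"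
    and \<Phi> :: "(nat, 'k ab_mor, ('o, 'm) endofun, ('o, 'm) nattrans) lfunctor"
    and L :: 'o
    and m\<^sub>L :: "'k poly"
  assumes "CHAR('k) \<noteq> 2"
    and "AB_module_category R \<Phi>"
    and "locally_finite_abelian R \<or> schurian TYPE('a) R"
    and "brick R L"
    and "is_dot_minpoly R \<Phi> L m\<^sub>L"
  shows "fps_to_fls (O_series R \<Phi> L) = O_rational m\<^sub>L"
  using AB_module_category.O_series_eq_O_rational [OF assms(2) two_neq_0_if_CHAR_neq_2]
    assms(1,4,5) by blast

end
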